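(* Let the problem data satisfy the function assumption, the graph assumption and the strong convexity assumption (with parameter $\mu>0$) of the context. Let $\kappa\in(0,1)$ and $c\in[\max\{\kappa,1-\kappa\},1)$, and for all $i\in[n]$ let $\{x_{i,t}\}$ be the sequences generated by Algorithm 1 (see context) with $$\alpha_t=\frac{1}{t^{c}},\quad \beta_t=\frac{1}{t^{\kappa}},\quad \gamma_t=\frac{1}{t^{1-\kappa}},\qquad \forall t\in\mathbb{N}_+ .$$ Then for any $T\in\mathbb{N}_+$, $$\mathrm{NetReg}(\{x_{i,t}\},\check{x}^*_{[T]})=\mathcal{O}(T^{\kappa}),\qquad \frac1n\sum_{i=1}^n\sum_{t=1}^T\|[g_t(x_{i,t})]_+\|=\mathcal{O}(T^{1-\kappa/2}),$$ where $\check{x}^*_{[T]}=(\check{x}^*_T,\dots,\check{x}^*_T)$ and $\check{x}^*_T\in\mathbb{X}$ is a minimizer of $\sum_{t=1}^Tf_t(x)$ over $x\in\mathbb{X}$ subject to $g_t(x)\le\mathbf{0}_m$ for all $t\in[T]$. Here $a=\mathcal{O}(b)$ means $a\le Cb$ for a constant $C>0$ depending only on $\kappa,c,\mu,n,m,F_1,F_2,R(\mathbb{X}),w,B$ (in particular not on $T$).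
   Context: Notation: $[n]=\{1,\dots,n\}$; $\|\cdot\|$ is the Euclidean norm for vectors and the induced 2-norm for matrices; $\mathbb{B}^p$ is the closed unit ball of $\mathbb{R}^p$; inequalities between vectors are componentwise; $\mathcal{P}_{\mathbb{K}}$ is Euclidean projection onto $\mathbb{K}$; $[\cdot]_+$ is the componentwise positive part. $\mathrm{col}(\cdot)$ stacks column vectors. Problem: $n$ agents, a set $\mathbb{X}\subseteq\mathbb{R}^p$, and arbitrary sequences of functions $f_{i,t}:\mathbb{X}\to\mathbb{R}$ (local losses) and $g_{i,t}:\mathbb{X}\to\mathbb{R}^{m_i}$ (local constraints), $i\in[n]$, $t\in\mathbb{N}_+$. Put $m=\sum_i m_i$, $f_t(x)=\frac1n\sum_{j=1}^nf_{j,t}(x)$, $g_t(x)=\mathrm{col}(g_{1,t}(x),\dots,g_{n,t}(x))\in\mathbb{R}^m$. For a sequence $y_{[T]}=(y_1,\dots,y_T)$, $$\mathrm{NetReg}(\{x_{i,t}\},y_{[T]})=\frac1n\sum_{i=1}^n\sum_{t=1}^Tf_t(x_{i,t})-\sum_{t=1}^Tf_t(y_t).$$ The set $\check{\mathcal{X}}_T=\{(x,\dots,x): x\in\mathbb{X},\ g_t(x)\le\mathbf{0}_m\ \forall t\in[T]\}$ is assumed non-empty for every $T\in\mathbb{N}_+$. Subgradients: $\partial f(x)$ denotes a (chosen) subgradient of a scalar function $f$ at $x$; for $g=(g_1,\dots,g_d)$, $\partial g(x)=[\partial g_1(x),\dots,\partial g_d(x)]\in\mathbb{R}^{p\times d}$.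 For scalar $f$, $\partial[f(x)]_+=\mathbf{0}_p$ if $f(x)<0$ and $\partial[f(x)]_+=\partial f(x)$ otherwise; for vector functions $\partial[g(x)]_+$ has columns $\partial[g_k(x)]_+$. Function assumption: (1) $\mathbb{X}$ is convex and closed with $r(\mathbb{X})\mathbb{B}^p\subseteq\mathbb{X}\subseteq R(\mathbb{X})\mathbb{B}^p$ for constants $0<r(\mathbb{X})\le R(\mathbb{X})$. (2) All $f_{i,t}$ and (componentwise) $g_{i,t}$ are convex, and there is a constant $F_1$ with $|f_{i,t}(x)-f_{i,t}(y)|\le F_1$, $\|g_{i,t}(x)\|\le F_1$ for all $i,t$ and $x,y\in\mathbb{X}$. (3) The subgradients $\partial f_{i,t}(x),\partial g_{i,t}(x)$ exist for all $x\in\mathbb{X}$, and there is a constant $F_2$ with $\|\partial f_{i,t}(x)\|\le F_2$, $\|\partial g_{i,t}(x)\|\le F_2$ for all $i,t$, $x\in\mathbb{X}$. Graph assumption: at each $t$ there is a directed graph $\mathcal{G}_t=([n],\mathcal{E}_t)$ and a matrix $W_t\in\mathbb{R}^{n\times n}$ with $[W_t]_{ij}>0$ if $(j,i)\in\mathcal{E}_t$ or $i=j$ and $[W_t]_{ij}=0$ otherwise, such that for every $t\in\mathbb{N}_+$: (a) for a constant $w\in(0,1)$, $[W_t]_{ij}\ge w$ whenever $[W_t]_{ij}>0$; (b) $W_t$ is doubly stochastic; (c) for a fixed integer $B>0$, $([n],\cup_{l=0}^{B-1}\mathcal{E}_{t+l})$ is strongly connected. Strong convexity assumption: there is $\mu>0$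 such that for all $i\in[n]$, $t\in\mathbb{N}_+$, $x,y\in\mathbb{X}$: $f_{i,t}(x)\ge f_{i,t}(y)+\langle x-y,\partial f_{i,t}(y)\rangle+\frac{\mu}{2}\|x-y\|^2$. Algorithm 1 (full-information feedback), with non-increasing positive sequences $\{\alpha_t\},\{\beta_t\},\{\gamma_t\}$: choose $x_{i,1}\in\mathbb{X}$ arbitrarily and $q_{i,1}=\mathbf{0}_{m_i}$; for $t=1,2,\dots$ and every $i\in[n]$, $$z_{i,t+1}=\sum_{j=1}^n[W_t]_{ij}x_{j,t},\quad \omega_{i,t+1}=\partial f_{i,t}(x_{i,t})+\partial[g_{i,t}(x_{i,t})]_+q_{i,t},\quad x_{i,t+1}=\mathcal{P}_{\mathbb{X}}(z_{i,t+1}-\alpha_{t+1}\omega_{i,t+1}),$$ $$q_{i,t+1}=\big[(1-\beta_{t+1}\gamma_{t+1})q_{i,t}+\gamma_{t+1}\big([g_{i,t}(x_{i,t})]_++(\partial[g_{i,t}(x_{i,t})]_+)^\top(x_{i,t+1}-x_{i,t})\big)\big]_+.$$ *)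

theory Defs
  imports "HOL-Analysis.Analysis" "Graph_Theory.Pair_Digraph" "Graph_Theory.Digraph_Component"
begin

(* The constants hidden in the O-notation must not depend on the dimension p of the decision space
   (nor on the individual dimensions m_i), so p has to be quantified inside the formula, after the
   constant, and cannot be a type.  Therefore all vectors live in one inner product space, the
   finitely supported real sequences, in which R^d is the subspace Rn d of the sequences whose
   coordinates with index >= d vanish.  Coordinates are numbered from 0. *)

typedef rseq = "{f :: nat \<Rightarrow> real. finite {k. f k \<noteq> 0}}"
  morphisms coord Abs_rseq
  by (rule exI[of _ "\<lambda>_. 0"]) simp

lemma finite_coord [simp]: "finite {k. coord x k \<noteq> 0}"
  using coord[of x] by simp

lemma coord_Abs: "finite {k. f k \<noteq> 0} \<Longrightarrow> coord (Abs_rseq f) = f"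
  by (simp add: Abs_rseq_inverse)

lemma rseq_eqI: "(\<And>k. coord x k = coord y k) \<Longrightarrow> x = y"
  by (metis coord_inject ext)

instantiation rseq :: real_vector
begin

definition "0 = Abs_rseq (\<lambda>_. 0)"
definition "x + y = Abs_rseq (\<lambda>k. coord x k + coord y k)"
definition "- x = Abs_rseq (\<lambda>k. - coord x k)"
definition "x - y = Abs_rseq (\<lambda>k. coord x k - coord y k)"
definition "a *\<^sub>R x = Abs_rseq (\<lambda>k. a * coord x k)"

lemma coord_zero: "coord 0 k = 0"
  by (simp add: zero_rseq_def coord_Abs)

lemma coord_add: "coord (x + y) k = coord x k + coord y k"
proof -
  have "finite {k. coord x k + coord y k \<noteq> 0}"
    by (rule finite_subset[of _ "{k. coord x k \<noteq> 0} \<union> {k. coord y k \<noteq> 0}"]) auto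
  then show ?thesis by (simp add: plus_rseq_def coord_Abs)
qed

lemma coord_minus: "coord (- x) k = - coord x k"
  by (simp add: uminus_rseq_def coord_Abs)

lemma coord_diff: "coord (x - y) k = coord x k - coord y k"
proof -
  have "finite {k. coord x k - coord y k \<noteq> 0}"
    by (rule finite_subset[of _ "{k. coord x k \<noteq> 0} \<union> {k. coord y k \<noteq> 0}"]) auto
  then show ?thesis by (simp add: minus_rseq_def coord_Abs)
qed

lemma coord_scaleR: "coord (a *\<^sub>R x) k = a * coord x k"
proof -
  have "finite {k. a * coord x k \<noteq> 0}"
    by (rule finite_subset[of _ "{k. coord x k \<noteq> 0}"]) auto
  then show ?thesis by (simp add: scaleR_rseq_def coord_Abs)
qed

instance
proof
  fix x y z :: rseq and a b :: real
  show "x + y + z = x + (y + z)" "x + y = y + x" "0 + x = x" "- x + x = 0" "x - y = x + - y"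
    by (rule rseq_eqI; simp add: coord_zero coord_add coord_minus coord_diff)+
  show "a *\<^sub>R (x + y) = a *\<^sub>R x + a *\<^sub>R y" "(a + b) *\<^sub>R x = a *\<^sub>R x + b *\<^sub>R x"
    "a *\<^sub>R b *\<^sub>R x = (a * b) *\<^sub>R x" "1 *\<^sub>R x = x"
    by (rule rseq_eqI; simp add: coord_add coord_scaleR algebra_simps)+
qed

end

instantiation rseq :: real_inner
begin

definition "inner x y = (\<Sum>k | coord x k \<noteq> 0. coord x k * coord y k)"
definition norm_rseq :: "rseq \<Rightarrow> real" where "norm_rseq x = sqrt (inner x x)"
definition sgn_rseq :: "rseq \<Rightarrow> rseq" where "sgn_rseq x = x /\<^sub>R norm x"
definition dist_rseq :: "rseq \<Rightarrow> rseq \<Rightarrow> real" where "dist_rseq x y = norm (x - y)"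
definition uniformity_rseq :: "(rseq \<times> rseq) filter"
  where "uniformity_rseq = (INF e\<in>{0<..}. principal {(x, y). dist x y < e})"
definition open_rseq :: "rseq set \<Rightarrow> bool"
  where "open_rseq U \<longleftrightarrow> (\<forall>x\<in>U. \<forall>\<^sub>F (x', y) in uniformity. x' = x \<longrightarrow> y \<in> U)"

lemma inner_rseq_superset:
  assumes "finite A" "{k. coord x k \<noteq> 0} \<subseteq> A"
  shows "inner x y = (\<Sum>k\<in>A. coord x k * coord y k)"
  unfolding inner_rseq_def by (rule sum.mono_neutral_left) (use assms in auto)

instance
proof
  fix x y z :: rseq and a b :: real
  let ?S = "{k. coord x k \<noteq> 0} \<union> {k. coord y k \<noteq> 0} \<union> {k. coord z k \<noteq> 0}"
  have fin: "finite ?S" by simp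
  show "sgn x = x /\<^sub>R norm x" "dist x y = norm (x - y)" "norm x = sqrt (inner x x)"
    by (simp_all add: sgn_rseq_def dist_rseq_def norm_rseq_def)
  show "(uniformity :: (rseq \<times> rseq) filter) = (INF e\<in>{0<..}. principal {(x, y). dist x y < e})"
    by (rule uniformity_rseq_def)
  show "open U \<longleftrightarrow> (\<forall>x\<in>U. \<forall>\<^sub>F (x', y) in uniformity. x' = x \<longrightarrow> y \<in> U)" for U :: "rseq set"
    by (rule open_rseq_def)
  have i: "inner u v = (\<Sum>k\<in>?S. coord u k * coord v k)" if "{k. coord u k \<noteq> 0} \<subseteq> ?S" for u v
    by (rule inner_rseq_superset[OF fin that])
  show "inner x y = inner y x"
    by (subst i, blast, subst i, blast) (simp add: mult.commute)
  show "inner (x + y) z = inner x z + inner y z"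
    by (subst i, force simp: coord_add, subst i, blast, subst i, blast)
      (simp add: coord_add distrib_right sum.distrib)
  show "inner (a *\<^sub>R x) y = a * inner x y"
    by (subst i, force simp: coord_scaleR, subst i, blast)
      (simp add: coord_scaleR sum_distrib_left mult.assoc)
  show "0 \<le> inner x x"
    unfolding inner_rseq_def by (rule sum_nonneg) simp
  have "inner x x = 0 \<longleftrightarrow> (\<forall>k\<in>{k. coord x k \<noteq> 0}. coord x k * coord x k = 0)"
    unfolding inner_rseq_def by (rule sum_nonneg_eq_0_iff) auto
  also have "\<dots> \<longleftrightarrow> x = 0"
    by (auto simp: coord_zero intro!: rseq_eqI)
  finally show "inner x x = 0 \<longleftrightarrow> x = 0" .
qed

end

definition Rn :: "nat \<Rightarrow> rseq set" where
  "Rn d = {x. \<forall>k\<ge>d. coord x k = 0}"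

lemma inner_Rn:
  assumes "x \<in> Rn d"
  shows "inner x y = (\<Sum>k<d. coord x k * coord y k)"
  by (rule inner_rseq_superset) (use assms in \<open>auto simp: Rn_def not_le [symmetric]\<close>)

definition vec_of :: "nat \<Rightarrow> (nat \<Rightarrow> real) \<Rightarrow> rseq" where
  "vec_of d h = Abs_rseq (\<lambda>k. if k < d then h k else 0)"

lemma coord_vec_of: "coord (vec_of d h) k = (if k < d then h k else 0)"
  unfolding vec_of_def by (subst coord_Abs) auto

definition pos_part :: "rseq \<Rightarrow> rseq" where
  "pos_part v = Abs_rseq (\<lambda>k. max 0 (coord v k))"

lemma coord_pos_part: "coord (pos_part v) k = max 0 (coord v k)"
proof -
  have "finite {k. max 0 (coord v k) \<noteq> 0}"
    by (rule finite_subset[of _ "{k. coord v k \<noteq> 0}"]) auto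
  then show ?thesis by (simp add: pos_part_def coord_Abs)
qed

definition col :: "nat \<Rightarrow> (nat \<Rightarrow> nat) \<Rightarrow> (nat \<Rightarrow> rseq) \<Rightarrow> rseq" where
  "col n m v =
    (let xs = concat (map (\<lambda>i. map (coord (v i)) [0..<m i]) [1..<n + 1])
     in vec_of (length xs) (\<lambda>k. xs ! k))"

(* A matrix with d columns is given by its columns A 0, ..., A (d - 1). *)

definition mat_vec :: "nat \<Rightarrow> (nat \<Rightarrow> rseq) \<Rightarrow> rseq \<Rightarrow> rseq" where
  "mat_vec d A v = (\<Sum>k<d. coord v k *\<^sub>R A k)"

definition transpose_mat_vec :: "nat \<Rightarrow> (nat \<Rightarrow> rseq) \<Rightarrow> rseq \<Rightarrow> rseq" where
  "transpose_mat_vec d A v = vec_of d (\<lambda>k. inner (A k) v)"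

(* As the map ignores the coordinates of its argument with index >= d, its operator norm on rseq is
   the one on R^d. *)
definition mat_norm :: "nat \<Rightarrow> (nat \<Rightarrow> rseq) \<Rightarrow> real" where
  "mat_norm d A = onorm (mat_vec d A)"

(* Same as closest_point, whose type class requires the Heine-Borel property. *)
definition proj_onto :: "rseq set \<Rightarrow> rseq \<Rightarrow> rseq" where
  "proj_onto K y = (SOME z. z \<in> K \<and> (\<forall>u\<in>K. dist y z \<le> dist y u))"

definition is_subgradient :: "nat \<Rightarrow> rseq set \<Rightarrow> (rseq \<Rightarrow> real) \<Rightarrow> rseq \<Rightarrow> rseq \<Rightarrow> bool" where
  "is_subgradient p X h x s \<longleftrightarrow> s \<in> Rn p \<and> (\<forall>y\<in>X. h y \<ge> h x + inner (y - x) s)"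

(* Below, f i t and g i t are the loss and constraint functions of agent i in {1..n} at time t >= 1
   (only their values on X matter), df i t x is the chosen subgradient of f i t at x, and
   dg i t x k is the chosen subgradient at x of component k of g i t. *)

type_synonym losses = "nat \<Rightarrow> nat \<Rightarrow> rseq \<Rightarrow> real"
type_synonym vec_funs = "nat \<Rightarrow> nat \<Rightarrow> rseq \<Rightarrow> rseq"
type_synonym jacobians = "nat \<Rightarrow> nat \<Rightarrow> rseq \<Rightarrow> nat \<Rightarrow> rseq"

definition global_loss :: "nat \<Rightarrow> losses \<Rightarrow> nat \<Rightarrow> rseq \<Rightarrow> real" where
  "global_loss n f t x = (\<Sum>j=1..n. f j t x) / real n"

definition global_constr :: "nat \<Rightarrow> (nat \<Rightarrow> nat) \<Rightarrow> vec_funs \<Rightarrow> nat \<Rightarrow> rseq \<Rightarrow> rseq" where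
  "global_constr n m g t x = col n m (\<lambda>i. g i t x)"

definition net_reg :: "nat \<Rightarrow> losses \<Rightarrow> (nat \<Rightarrow> nat \<Rightarrow> rseq) \<Rightarrow> (nat \<Rightarrow> rseq) \<Rightarrow> nat \<Rightarrow> real" where
  "net_reg n f x y T =
    (\<Sum>i=1..n. \<Sum>t=1..T. global_loss n f t (x i t)) / real n - (\<Sum>t=1..T. global_loss n f t (y t))"

definition feasible_points :: "rseq set \<Rightarrow> nat \<Rightarrow> (nat \<Rightarrow> nat) \<Rightarrow> vec_funs \<Rightarrow> nat \<Rightarrow> rseq set" where
  "feasible_points X n m g T =
    {x \<in> X. \<forall>t\<in>{1..T}. \<forall>k<(\<Sum>i=1..n. m i). coord (global_constr n m g t x) k \<le> 0}"

definition function_assumption ::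
  "nat \<Rightarrow> rseq set \<Rightarrow> real \<Rightarrow> real \<Rightarrow> nat \<Rightarrow> (nat \<Rightarrow> nat) \<Rightarrow> losses \<Rightarrow> vec_funs \<Rightarrow> vec_funs \<Rightarrow> jacobians
    \<Rightarrow> real \<Rightarrow> real \<Rightarrow> bool" where
  "function_assumption p X r R n m f g df dg F1 F2 \<longleftrightarrow>
    convex X \<and> closed X \<and> 0 < r \<and> r \<le> R \<and>
    cball 0 r \<inter> Rn p \<subseteq> X \<and> X \<subseteq> cball 0 R \<inter> Rn p \<and>
    (\<forall>i\<in>{1..n}. \<forall>t\<ge>1.
      convex_on X (f i t) \<and>
      (\<forall>x\<in>X. g i t x \<in> Rn (m i)) \<and>
      (\<forall>k<m i. convex_on X (\<lambda>x. coord (g i t x) k)) \<and>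
      (\<forall>x\<in>X. \<forall>y\<in>X. \<bar>f i t x - f i t y\<bar> \<le> F1) \<and>
      (\<forall>x\<in>X. norm (g i t x) \<le> F1) \<and>
      (\<forall>x\<in>X. is_subgradient p X (f i t) x (df i t x)) \<and>
      (\<forall>x\<in>X. \<forall>k<m i. is_subgradient p X (\<lambda>y. coord (g i t y) k) x (dg i t x k)) \<and>
      (\<forall>x\<in>X. norm (df i t x) \<le> F2 \<and> mat_norm (m i) (dg i t x) \<le> F2))"

definition doubly_stochastic :: "nat \<Rightarrow> (nat \<Rightarrow> nat \<Rightarrow> real) \<Rightarrow> bool" where
  "doubly_stochastic n A \<longleftrightarrow>
    (\<forall>i\<in>{1..n}. \<forall>j\<in>{1..n}. 0 \<le> A i j) \<and>
    (\<forall>i\<in>{1..n}. (\<Sum>j=1..n. A i j) = 1) \<and>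
    (\<forall>j\<in>{1..n}. (\<Sum>i=1..n. A i j) = 1)"

definition graph_assumption ::
  "nat \<Rightarrow> (nat \<Rightarrow> (nat \<times> nat) set) \<Rightarrow> (nat \<Rightarrow> nat \<Rightarrow> nat \<Rightarrow> real) \<Rightarrow> real \<Rightarrow> nat \<Rightarrow> bool" where
  "graph_assumption n E W w B \<longleftrightarrow>
    0 < w \<and> w < 1 \<and> 0 < B \<and>
    (\<forall>t\<ge>1.
      E t \<subseteq> {1..n} \<times> {1..n} \<and>
      (\<forall>i\<in>{1..n}. \<forall>j\<in>{1..n}.
        if (j, i) \<in> E t \<or> i = j then W t i j > 0 else W t i j = 0) \<and>
      (\<forall>i\<in>{1..n}. \<forall>j\<in>{1..n}. W t i j > 0 \<longrightarrow> W t i j \<ge> w) \<and>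
      doubly_stochastic n (W t) \<and>
      strongly_connected (with_proj \<lparr>pverts = {1..n}, parcs = (\<Union>l\<in>{0..B - 1}. E (t + l))\<rparr>))"

definition strong_convexity_assumption ::
  "rseq set \<Rightarrow> nat \<Rightarrow> losses \<Rightarrow> vec_funs \<Rightarrow> real \<Rightarrow> bool" where
  "strong_convexity_assumption X n f df \<mu> \<longleftrightarrow>
    0 < \<mu> \<and>
    (\<forall>i\<in>{1..n}. \<forall>t\<ge>1. \<forall>x\<in>X. \<forall>y\<in>X.
      f i t x \<ge> f i t y + inner (x - y) (df i t y) + \<mu> / 2 * (norm (x - y))\<^sup>2)"

definition d_pos_part :: "vec_funs \<Rightarrow> jacobians \<Rightarrow> jacobians" where
  "d_pos_part g dg i t x k = (if coord (g i t x) k < 0 then 0 else dg i t x k)"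

definition algorithm1 ::
  "rseq set \<Rightarrow> nat \<Rightarrow> (nat \<Rightarrow> nat) \<Rightarrow> vec_funs \<Rightarrow> vec_funs \<Rightarrow> jacobians \<Rightarrow> (nat \<Rightarrow> nat \<Rightarrow> nat \<Rightarrow> real)
    \<Rightarrow> (nat \<Rightarrow> real) \<Rightarrow> (nat \<Rightarrow> real) \<Rightarrow> (nat \<Rightarrow> real)
    \<Rightarrow> (nat \<Rightarrow> nat \<Rightarrow> rseq) \<Rightarrow> (nat \<Rightarrow> nat \<Rightarrow> rseq) \<Rightarrow> bool" where
  "algorithm1 X n m g df dg W \<alpha> \<beta> \<gamma> x q \<longleftrightarrow>
    (\<forall>i\<in>{1..n}. x i 1 \<in> X \<and> q i 1 = 0) \<and>
    (\<forall>t\<ge>1. \<forall>i\<in>{1..n}.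
      let z = (\<Sum>j=1..n. W t i j *\<^sub>R x j t);
          G = d_pos_part g dg i t (x i t);
          \<omega> = df i t (x i t) + mat_vec (m i) G (q i t)
      in x i (t + 1) = proj_onto X (z - \<alpha> (t + 1) *\<^sub>R \<omega>) \<and>
         q i (t + 1) =
           pos_part ((1 - \<beta> (t + 1) * \<gamma> (t + 1)) *\<^sub>R q i t
             + \<gamma> (t + 1) *\<^sub>R (pos_part (g i t (x i t))
                 + transpose_mat_vec (m i) G (x i (t + 1) - x i t))))"

end

theory Submission
  imports Defs
begin

text \<open>Fix a feasible point \<open>y\<close> and a dual vector \<open>u\<close> with non-negative entries. Adding the projection
  inequality of the primal step, strong convexity and the expansion of \<open>\<parallel>q\<^sub>t - u\<parallel>\<^sup>2\<close> gives a one-step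
  inequality for every agent in which \<open>\<langle>q\<^sub>t, b\<^sub>t\<rangle>\<close> cancels. Summed over the agents and over time, the
  primal distances telescope up to \<open>1 / \<alpha>\<^sub>t\<^sub>+\<^sub>1 - 1 / \<alpha>\<^sub>t - \<mu>\<close>, which is positive only finitely often because
  \<open>c < 1\<close>; the dual distances telescope because \<open>1 / \<gamma>\<^sub>t\<^sub>+\<^sub>1 - 1 / \<gamma>\<^sub>t \<le> \<beta>\<^sub>t\<^sub>+\<^sub>1\<close>. The movement of the agents and
  their disagreement are linear in the projection errors \<open>\<epsilon>\<^sub>t\<close>, since averaging over \<open>n B\<close> rounds contracts
  the diameter of the states, and are absorbed by the negative terms \<open>- \<parallel>\<epsilon>\<^sub>t\<parallel>\<^sup>2 / (2 \<alpha>\<^sub>t)\<close> at the price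
  of \<open>\<Sum> \<alpha>\<^sub>t\<close>.

  Taking \<open>u = 0\<close> yields the regret bound. Taking all entries of \<open>u\<close> equal to \<open>T\<^sup>\<kappa>\<^sup>/\<^sup>2\<close> bounds the
  violation multiplied by \<open>T\<^sup>\<kappa>\<^sup>/\<^sup>2\<close> by a multiple of \<open>T\<close>, because the regret is at least \<open>- n F\<^sub>1 T\<close>.\<close>

section \<open>Finitely supported sequences\<close>

lemma coord_sum: "coord (\<Sum>i\<in>A. v i) k = (\<Sum>i\<in>A. coord (v i) k)"
  by (induction A rule: infinite_finite_induct) (auto simp: coord_zero coord_add)

lemma Rn_zero [simp]: "0 \<in> Rn d"
  by (simp add: Rn_def coord_zero)

lemma Rn_vec_of [simp]: "vec_of d h \<in> Rn d"
  by (simp add: Rn_def coord_vec_of)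

lemma Rn_pos_part: "x \<in> Rn d \<Longrightarrow> pos_part x \<in> Rn d"
  by (simp add: Rn_def coord_pos_part)

lemma norm_Rn_squared:
  assumes "x \<in> Rn d"
  shows "(norm x)\<^sup>2 = (\<Sum>k<d. (coord x k)\<^sup>2)"
  unfolding power2_norm_eq_inner inner_Rn[OF assms] by (simp add: power2_eq_square)

lemma norm_le_coord:
  assumes "\<And>k. \<bar>coord x k\<bar> \<le> \<bar>coord y k\<bar>"
  shows "norm x \<le> norm y"
proof -
  have sub: "{k. coord x k \<noteq> 0} \<subseteq> {k. coord y k \<noteq> 0}"
    using assms by (metis (mono_tags, lifting) Collect_mono abs_eq_0 abs_le_zero_iff)
  have "inner x x = (\<Sum>k | coord y k \<noteq> 0. coord x k * coord x k)"
    by (rule inner_rseq_superset) (use sub in auto)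
  also have "\<dots> \<le> (\<Sum>k | coord y k \<noteq> 0. coord y k * coord y k)"
    by (intro sum_mono) (metis assms abs_mult_self_eq abs_ge_zero mult_mono)
  also have "\<dots> = inner y y"
    by (rule inner_rseq_superset[symmetric]) auto
  finally show ?thesis
    by (simp add: norm_le)
qed

lemma abs_coord_le_norm: "\<bar>coord x k\<bar> \<le> norm x"
proof (cases "coord x k = 0")
  case False
  have "(coord x k)\<^sup>2 \<le> (\<Sum>j | coord x j \<noteq> 0. coord x j * coord x j)"
    using False by (auto simp: power2_eq_square intro!: member_le_sum)
  then have "(coord x k)\<^sup>2 \<le> (norm x)\<^sup>2"
    by (simp add: power2_norm_eq_inner inner_rseq_def)
  then show ?thesis
    by (metis abs_le_square_iff abs_norm_cancel)
qed auto

lemma bounded_linear_coord: "bounded_linear (\<lambda>x. coord x k)"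
  by (rule bounded_linear_intro[where K = 1])
    (auto simp: coord_add coord_scaleR abs_coord_le_norm)

lemma norm_le_sum_coord:
  assumes "x \<in> Rn d"
  shows "norm x \<le> (\<Sum>k<d. \<bar>coord x k\<bar>)"
proof -
  have "norm x = L2_set (coord x) {..<d}"
    by (simp add: L2_set_def flip: norm_Rn_squared[OF assms])
  then show ?thesis
    by (simp add: L2_set_le_sum_abs)
qed

lemma norm_vec_of_const:
  "(norm (vec_of d (\<lambda>_. s)))\<^sup>2 = real d * s\<^sup>2"
  by (simp add: norm_Rn_squared[of _ d] coord_vec_of)

lemma norm_pos_part_le: "norm (pos_part x) \<le> norm x"
  by (rule norm_le_coord) (auto simp: coord_pos_part)

lemma norm_pos_part_diff_le:
  assumes "\<And>k. 0 \<le> coord u k"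
  shows "norm (pos_part x - u) \<le> norm (x - u)"
proof (rule norm_le_coord)
  fix k
  show "\<bar>coord (pos_part x - u) k\<bar> \<le> \<bar>coord (x - u) k\<bar>"
    using assms[of k] by (auto simp: coord_pos_part coord_diff)
qed

section \<open>Matrices given by columns, their adjoints and operator norms\<close>

lemma bounded_linear_mat_vec: "bounded_linear (mat_vec d A)"
  unfolding mat_vec_def
  by (intro bounded_linear_sum bounded_linear_scaleR_left[THEN bounded_linear_compose]
      bounded_linear_coord)

lemma norm_mat_vec_le: "norm (mat_vec d A v) \<le> mat_norm d A * norm v"
  unfolding mat_norm_def by (rule onorm[OF bounded_linear_mat_vec])

lemma inner_mat_vec: "inner (mat_vec d A v) u = inner v (transpose_mat_vec d A u)"
proof -
  have "inner v (transpose_mat_vec d A u) = (\<Sum>k<d. inner (A k) u * coord v k)"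
    by (subst inner_commute)
      (simp add: transpose_mat_vec_def inner_Rn[of _ d] coord_vec_of)
  then show ?thesis
    by (simp add: mat_vec_def inner_sum_left mult.commute)
qed

text \<open>An adjoint inherits the bound of the operator. With \<open>s\<close> the transposed
  product, adjointness gives \<open>norm s * norm s = inner (mat_vec d A s) u\<close>, and one
  factor \<open>norm s\<close> cancels.\<close>

lemma norm_transpose_mat_vec_le:
  assumes "\<And>v. norm (mat_vec d A v) \<le> F * norm v"
  shows "norm (transpose_mat_vec d A u) \<le> F * norm u"
proof (cases "transpose_mat_vec d A u = 0")
  case True
  have "0 \<le> F * norm u"
    using norm_ge_zero order_trans[OF _ assms] by blast
  then show ?thesis using True by simp
next
  case False
  let ?s = "transpose_mat_vec d A u"
  have "norm ?s * norm ?s = inner (mat_vec d A ?s) u"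
    by (simp add: inner_mat_vec dot_square_norm power2_eq_square)
  also have "\<dots> \<le> norm (mat_vec d A ?s) * norm u"
    by (rule norm_cauchy_schwarz)
  also have "\<dots> \<le> (F * norm ?s) * norm u"
    by (intro mult_right_mono assms) auto
  finally have "norm ?s * norm ?s \<le> norm ?s * (F * norm u)"
    by (simp add: mult_ac)
  then show ?thesis
    using False by simp
qed

text \<open>Deleting the columns of inactive constraints has the same effect as zeroing the matching
  coordinates of \<open>v\<close>, which cannot increase its norm.\<close>

lemma norm_mat_vec_d_pos_part_le:
  assumes "mat_norm d (dg i t x) \<le> F"
  shows "norm (mat_vec d (d_pos_part g dg i t x) v) \<le> F * norm v"
proof -
  let ?v = "vec_of d (\<lambda>k. if coord (g i t x) k < 0 then 0 else coord v k)"
  have "mat_vec d (d_pos_part g dg i t x) v = mat_vec d (dg i t x) ?v"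
    unfolding mat_vec_def by (rule sum.cong) (auto simp: d_pos_part_def coord_vec_of)
  also have "norm \<dots> \<le> mat_norm d (dg i t x) * norm ?v"
    by (rule norm_mat_vec_le)
  also have "\<dots> \<le> mat_norm d (dg i t x) * norm v"
    by (intro mult_left_mono norm_le_coord)
      (auto simp: coord_vec_of mat_norm_def intro: onorm_pos_le bounded_linear_mat_vec)
  also have "\<dots> \<le> F * norm v"
    by (intro mult_right_mono assms) auto
  finally show ?thesis .
qed

text \<open>The ambient space has infinite dimension, so Heine-Borel is recovered on the slice
  \<open>Rn p\<close>: the set is a closed part of the continuous image of a product of intervals,
  which is compact by Tychonoff.\<close>

lemma compact_Rn_subset:
  assumes "closed K" "K \<subseteq> cball 0 R \<inter> Rn p"
  shows "compact K"
proof -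
  let ?H = "Pi\<^sub>E UNIV (\<lambda>_::nat. {- R..R})"
  let ?e = "\<lambda>k. vec_of p (\<lambda>j. if j = k then 1 else 0)"
  \<comment> \<open>As a finite linear combination of unit vectors, \<open>vec_of p\<close> is
    visibly continuous for the product topology.\<close>
  have vec: "vec_of p h = (\<Sum>k<p. h k *\<^sub>R ?e k)" for h
    by (rule rseq_eqI)
      (simp add: coord_vec_of coord_sum coord_scaleR if_distrib[of "(*) _"] cong: if_cong)
  have "compact ?H"
    using compactin_PiE[of "\<lambda>_::nat. euclidean :: real topology" UNIV "\<lambda>_. {- R..R}"]
    by (simp add: euclidean_product_topology)
  moreover have "continuous_on ?H (\<lambda>h. \<Sum>k<p. h k *\<^sub>R ?e k)"
    by (intro continuous_intros continuous_on_subset[OF continuous_on_product_coordinates]) auto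
  then have "continuous_on ?H (vec_of p)"
    by (simp only: vec[symmetric])
  ultimately have "compact (vec_of p ` ?H)"
    by (rule compact_continuous_image[rotated])
  moreover have "K \<subseteq> vec_of p ` ?H"
  proof
    fix x assume "x \<in> K"
    then have x: "norm x \<le> R" "x \<in> Rn p"
      using assms(2) by auto
    have "x = vec_of p (coord x)"
      using x by (auto intro!: rseq_eqI simp: coord_vec_of Rn_def)
    moreover have "\<bar>coord x k\<bar> \<le> R" for k
      using abs_coord_le_norm[of x k] x by linarith
    then have "coord x \<in> ?H"
      by (auto simp: PiE_def abs_le_iff minus_le_iff)
    ultimately show "x \<in> vec_of p ` ?H"
      by blast
  qed
  ultimately show ?thesis
    by (metis assms(1) closed_Int_compact inf.absorb1)
qed

lemma proj_onto_closest:
  assumes "compact K" "K \<noteq> {}"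
  shows "proj_onto K y \<in> K" "\<forall>u\<in>K. dist y (proj_onto K y) \<le> dist y u"
proof -
  have "\<exists>z. z \<in> K \<and> (\<forall>u\<in>K. dist y z \<le> dist y u)"
    using continuous_attains_inf[OF assms continuous_on_dist[OF continuous_on_const continuous_on_id]]
    by blast
  from someI_ex[OF this]
  show "proj_onto K y \<in> K" "\<forall>u\<in>K. dist y (proj_onto K y) \<le> dist y u"
    unfolding proj_onto_def by auto
qed

text \<open>The obtuse-angle property of a closest point in a convex set, tested at
  \<open>y\<close>. Expanding the inner product by polarisation produces the three squared
  distances.\<close>

lemma proj_onto_step:
  fixes z \<omega> y :: rseq and \<alpha> :: real
  assumes "compact K" "convex K" "y \<in> K"
  defines "x \<equiv> proj_onto K (z - \<alpha> *\<^sub>R \<omega>)"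
  shows "2 * \<alpha> * inner \<omega> (x - y) \<le> (norm (z - y))\<^sup>2 - (norm (x - y))\<^sup>2 - (norm (x - z))\<^sup>2"
proof -
  have "inner (z - \<alpha> *\<^sub>R \<omega> - x) (y - x) \<le> 0"
    unfolding x_def using assms proj_onto_closest[OF assms(1)]
    by (intro any_closest_point_dot[of K]) (auto intro: compact_imp_closed)
  then show ?thesis
    by (simp add: power2_norm_eq_inner algebra_simps inner_commute)
qed

section \<open>Stacking the local constraint vectors\<close>

lemma sum_list_1_n: "(\<Sum>i\<leftarrow>[1..<n + 1]. h i) = (\<Sum>i=1..n. h i)"
  by (induction n) (auto simp: add.commute)

lemma col_list:
  fixes v :: "nat \<Rightarrow> rseq" and m :: "nat \<Rightarrow> nat" and n :: nat
  defines "xs \<equiv> concat (map (\<lambda>i. map (coord (v i)) [0..<m i]) [1..<n + 1])"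
  shows "col n m v = vec_of (length xs) ((!) xs)" "length xs = (\<Sum>i=1..n. m i)"
proof -
  show "col n m v = vec_of (length xs) ((!) xs)"
    by (simp add: col_def xs_def)
  show "length xs = (\<Sum>i=1..n. m i)"
    unfolding xs_def sum_list_1_n[symmetric] by (simp add: length_concat o_def del: upt_Suc)
qed

lemma col_nonpos_iff:
  "(\<forall>k<(\<Sum>i=1..n. m i). coord (col n m v) k \<le> 0) \<longleftrightarrow> (\<forall>i\<in>{1..n}. \<forall>k<m i. coord (v i) k \<le> 0)"
proof -
  let ?xs = "concat (map (\<lambda>i. map (coord (v i)) [0..<m i]) [1..<n + 1])"
  have "(\<forall>k<(\<Sum>i=1..n. m i). coord (col n m v) k \<le> 0) \<longleftrightarrow> (\<forall>a\<in>set ?xs. a \<le> 0)"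
    unfolding col_list(1) col_list(2)[symmetric, of m n v] all_set_conv_all_nth
    by (auto simp: coord_vec_of)
  also have "\<dots> \<longleftrightarrow> (\<forall>i\<in>{1..n}. \<forall>k<m i. coord (v i) k \<le> 0)"
    by (auto simp del: upt_Suc)
  finally show ?thesis .
qed

lemma sum_list_concat_map: "sum_list (concat (map h xs)) = (\<Sum>x\<leftarrow>xs. sum_list (h x))"
  for h :: "'a \<Rightarrow> 'b::monoid_add list"
  by (induction xs) auto

text \<open>The squared norm of the stacked vector is the sum of the squared norms of its blocks,
  and an l2 norm is at most the l1 norm.\<close>

lemma norm_pos_part_col_le:
  assumes "\<And>i. i \<in> {1..n} \<Longrightarrow> v i \<in> Rn (m i)"
  shows "norm (pos_part (col n m v)) \<le> (\<Sum>i=1..n. norm (pos_part (v i)))"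
proof -
  let ?xs = "concat (map (\<lambda>i. map (coord (v i)) [0..<m i]) [1..<n + 1])"
  have "(norm (pos_part (col n m v)))\<^sup>2 = (\<Sum>k<length ?xs. (max 0 (?xs ! k))\<^sup>2)"
    unfolding col_list(1)
    by (simp add: norm_Rn_squared[OF Rn_pos_part[OF Rn_vec_of]] coord_pos_part coord_vec_of
        del: upt_Suc)
  also have "\<dots> = (\<Sum>a\<leftarrow>?xs. (max 0 a)\<^sup>2)"
    by (simp add: sum_list_sum_nth lessThan_atLeast0 del: upt_Suc)
  also have "\<dots> = (\<Sum>i=1..n. \<Sum>k<m i. (max 0 (coord (v i) k))\<^sup>2)"
    unfolding sum_list_1_n[symmetric]
    by (simp add: map_concat o_def sum_list_concat_map interv_sum_list_conv_sum_set_nat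
        lessThan_atLeast0 del: upt_Suc)
  also have "\<dots> = (\<Sum>i=1..n. (norm (pos_part (v i)))\<^sup>2)"
    by (intro sum.cong refl)
      (simp only: norm_Rn_squared[OF Rn_pos_part[OF assms]] coord_pos_part)
  finally have "norm (pos_part (col n m v)) = L2_set (\<lambda>i. norm (pos_part (v i))) {1..n}"
    unfolding L2_set_def by (metis norm_ge_zero real_sqrt_abs abs_of_nonneg)
  then show ?thesis
    by (simp add: L2_set_le_sum)
qed

section \<open>Consensus over time-varying graphs\<close>

definition weights :: "'i set \<Rightarrow> ('i \<Rightarrow> real) \<Rightarrow> bool" where
  "weights I a \<longleftrightarrow> (\<forall>i\<in>I. 0 \<le> a i) \<and> sum a I = 1"

text \<open>Both combinations are expanded over the product weights \<open>a j * b k\<close>, a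
  coupling of the two distributions. Their difference then involves only pairwise differences of the
  points.\<close>

lemma convex_combination_diff:
  fixes x :: "'i \<Rightarrow> 'v::real_vector"
  assumes "weights I a" "weights I b"
  shows "(\<Sum>j\<in>I. a j *\<^sub>R x j) - (\<Sum>k\<in>I. b k *\<^sub>R x k)
    = (\<Sum>j\<in>I. \<Sum>k\<in>I. (a j * b k) *\<^sub>R (x j - x k))"
proof -
  have "(\<Sum>j\<in>I. \<Sum>k\<in>I. (a j * b k) *\<^sub>R x j) = (\<Sum>j\<in>I. a j *\<^sub>R x j)"
    using assms by (simp add: weights_def flip: scaleR_left.sum sum_distrib_left)
  moreover have "(\<Sum>j\<in>I. \<Sum>k\<in>I. (a j * b k) *\<^sub>R x k) = (\<Sum>k\<in>I. b k *\<^sub>R x k)"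
    using assms
    by (subst sum.swap) (simp add: weights_def flip: scaleR_left.sum sum_distrib_right)
  ultimately show ?thesis
    by (simp add: scaleR_diff_right sum_subtractf)
qed

text \<open>In the double sum of the previous lemma the diagonal terms vanish, so the weight
  \<^term>\<open>a i * b i\<close> of a common index is lost.\<close>

lemma norm_convex_combination_diff_le:
  fixes x :: "'i \<Rightarrow> 'v::real_normed_vector"
  assumes ab: "weights I a" "weights I b" and I: "finite I" "i \<in> I"
    and h: "0 \<le> h" "h \<le> a i" "h \<le> b i"
    and D: "\<And>j k. j \<in> I \<Longrightarrow> k \<in> I \<Longrightarrow> norm (x j - x k) \<le> D"
  shows "norm ((\<Sum>j\<in>I. a j *\<^sub>R x j) - (\<Sum>k\<in>I. b k *\<^sub>R x k)) \<le> (1 - h\<^sup>2) * D"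
proof -
  have D0: "0 \<le> D"
    using D[OF I(2) I(2)] by simp
  have ab0: "\<And>j. j \<in> I \<Longrightarrow> 0 \<le> a j" "\<And>j. j \<in> I \<Longrightarrow> 0 \<le> b j"
    using ab by (auto simp: weights_def)
  have "norm ((\<Sum>j\<in>I. a j *\<^sub>R x j) - (\<Sum>k\<in>I. b k *\<^sub>R x k))
      \<le> (\<Sum>j\<in>I. \<Sum>k\<in>I. a j * b k * norm (x j - x k))"
    unfolding convex_combination_diff[OF ab]
    by (intro sum_norm_le order_trans[OF norm_sum] sum_mono) (simp add: ab0 abs_mult)
  also have "\<dots> \<le> (\<Sum>j\<in>I. \<Sum>k\<in>I. a j * b k * D - (if k = i then if j = i then a i * b i * D else 0 else 0))"
    using D by (intro sum_mono) (auto intro!: mult_left_mono mult_nonneg_nonneg simp: ab0)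
  also have "\<dots> = (\<Sum>j\<in>I. a j) * (\<Sum>k\<in>I. b k) * D - a i * b i * D"
    using I by (simp add: sum_subtractf flip: sum_distrib_left sum_distrib_right)
  also have "\<dots> = (1 - a i * b i) * D"
    using ab by (simp add: weights_def algebra_simps)
  also have "\<dots> \<le> (1 - h\<^sup>2) * D"
    using h D0 unfolding power2_eq_square by (intro mult_right_mono) (auto intro: mult_mono)
  finally show ?thesis .
qed

text \<open>The matrix product \<open>W (t + k - 1) ... W t\<close>, with the latest factor on the
  left: row \<open>i\<close> holds the weights that agent \<open>i\<close> gives after
  \<open>k\<close> rounds to the states of round \<open>t\<close>.\<close>

primrec transition :: "nat \<Rightarrow> (nat \<Rightarrow> nat \<Rightarrow> nat \<Rightarrow> real) \<Rightarrow> nat \<Rightarrow> nat \<Rightarrow> nat \<Rightarrow> nat \<Rightarrow> real" where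
  "transition n W t 0 i j = (if i = j then 1 else 0)"
| "transition n W t (Suc k) i j = (\<Sum>l=1..n. W (t + k) i l * transition n W t k l j)"

text \<open>A path from \<open>u\<close> inside \<open>S\<close> to \<open>v\<close> outside must
  use an edge that crosses the boundary of \<open>S\<close>.\<close>

lemma strongly_connected_leaves:
  assumes "strongly_connected (with_proj \<lparr>pverts = V, parcs = A\<rparr>)"
    and "u \<in> S" "u \<in> V" "v \<in> V" "v \<notin> S"
  obtains a b where "(a, b) \<in> A" "a \<in> S" "b \<in> V" "b \<notin> S"
proof -
  have "(u, v) \<in> rtrancl_on V A"
    using assms by (auto simp: strongly_connected_def reachable_def)
  moreover have "\<exists>a b. (a, b) \<in> A \<and> a \<in> S \<and> b \<in> V \<and> b \<notin> S"
    if "(u, v) \<in> rtrancl_on V A" "v \<notin> S" for v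
    using that by (induction rule: rtrancl_on_induct) (use \<open>u \<in> S\<close> in blast)+
  ultimately show ?thesis
    using \<open>v \<notin> S\<close> that by blast
qed

section \<open>Uniform positivity of products of the weight matrices\<close>

locale network =
  fixes n :: nat and E :: "nat \<Rightarrow> (nat \<times> nat) set" and W :: "nat \<Rightarrow> nat \<Rightarrow> nat \<Rightarrow> real"
    and w :: real and B :: nat
  assumes n_pos: "1 \<le> n" and graph: "graph_assumption n E W w B"
begin

lemma w: "0 < w" "w < 1" and B_pos: "0 < B"
  using graph by (auto simp: graph_assumption_def)

lemma W_nonneg: "1 \<le> t \<Longrightarrow> i \<in> {1..n} \<Longrightarrow> j \<in> {1..n} \<Longrightarrow> 0 \<le> W t i j"
  and W_row: "1 \<le> t \<Longrightarrow> i \<in> {1..n} \<Longrightarrow> (\<Sum>j=1..n. W t i j) = 1"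
  and W_column: "1 \<le> t \<Longrightarrow> j \<in> {1..n} \<Longrightarrow> (\<Sum>i=1..n. W t i j) = 1"
  using graph unfolding graph_assumption_def doubly_stochastic_def by blast+

lemma W_edge: "1 \<le> t \<Longrightarrow> i \<in> {1..n} \<Longrightarrow> j \<in> {1..n} \<Longrightarrow> (j, i) \<in> E t \<or> i = j \<Longrightarrow> w \<le> W t i j"
  using graph unfolding graph_assumption_def by metis

lemma transition_nonneg: "1 \<le> t \<Longrightarrow> i \<in> {1..n} \<Longrightarrow> j \<in> {1..n} \<Longrightarrow> 0 \<le> transition n W t k i j"
  by (induction k arbitrary: i) (auto intro!: sum_nonneg mult_nonneg_nonneg W_nonneg)

lemma transition_row:
  assumes "1 \<le> t" "i \<in> {1..n}"
  shows "(\<Sum>j=1..n. transition n W t k i j) = 1"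
  using assms(2)
proof (induction k arbitrary: i)
  case (Suc k)
  have "(\<Sum>j=1..n. transition n W t (Suc k) i j)
      = (\<Sum>l=1..n. W (t + k) i l * (\<Sum>j=1..n. transition n W t k l j))"
    by (simp only: transition.simps sum_distrib_left) (rule sum.swap)
  also have "\<dots> = (\<Sum>l=1..n. W (t + k) i l)"
    by (intro sum.cong) (simp_all add: Suc.IH del: One_nat_def)
  finally show ?case
    using W_row[of "t + k"] Suc.prems assms(1) by simp
qed simp

lemma weights_transition: "1 \<le> t \<Longrightarrow> i \<in> {1..n} \<Longrightarrow> weights {1..n} (transition n W t k i)"
  using transition_nonneg transition_row by (simp add: weights_def)

lemma transition_step:
  assumes "1 \<le> t" "i \<in> {1..n}" "l \<in> {1..n}" "j \<in> {1..n}"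
    and "(l, i) \<in> E (t + k) \<or> i = l" "w ^ k \<le> transition n W t k l j"
  shows "w ^ Suc k \<le> transition n W t (Suc k) i j"
proof -
  have "w ^ Suc k \<le> W (t + k) i l * transition n W t k l j"
    unfolding power_Suc using assms w by (intro mult_mono W_edge) (auto intro: W_nonneg)
  also have "\<dots> \<le> transition n W t (Suc k) i j"
    using assms unfolding transition.simps
    by (intro member_le_sum) (auto intro!: mult_nonneg_nonneg W_nonneg transition_nonneg)
  finally show ?thesis .
qed

text \<open>The agents that information from \<open>j\<close> has reached after \<open>k\<close>
  rounds. The threshold falls by \<open>w\<close> per round because one edge costs at most that
  factor.\<close>

definition heavy :: "nat \<Rightarrow> nat \<Rightarrow> nat \<Rightarrow> nat set" where
  "heavy t k j = {i \<in> {1..n}. w ^ k \<le> transition n W t k i j}"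

text \<open>The self-loops keep an agent heavy: its own weight is at least \<open>w\<close>, which
  matches the drop of the threshold.\<close>

lemma heavy_step: "1 \<le> t \<Longrightarrow> j \<in> {1..n} \<Longrightarrow> heavy t k j \<subseteq> heavy t (Suc k) j"
  using transition_step unfolding heavy_def by blast

lemma heavy_mono: "1 \<le> t \<Longrightarrow> j \<in> {1..n} \<Longrightarrow> k \<le> k' \<Longrightarrow> heavy t k j \<subseteq> heavy t k' j"
  by (rule lift_Suc_mono_le[where f = "\<lambda>k. heavy t k j"]) (use heavy_step in auto)

text \<open>As long as some agent is not yet heavy, the strongly connected union graph over the next
  \<^term>\<open>B\<close> steps has an edge leaving the set of heavy agents, so the set grows.\<close>

lemma heavy_grows:
  assumes t: "1 \<le> t" and j: "j \<in> {1..n}" and "heavy t k j \<noteq> {1..n}" "j \<in> heavy t k j"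
  shows "heavy t k j \<subset> heavy t (k + B) j"
proof -
  obtain v where v: "v \<in> {1..n}" "v \<notin> heavy t k j"
    using \<open>heavy t k j \<noteq> {1..n}\<close> heavy_def by blast
  have "1 \<le> t + k" using t by simp
  then have "strongly_connected (with_proj \<lparr>pverts = {1..n}, parcs = (\<Union>l\<in>{0..B - 1}. E ((t + k) + l))\<rparr>)"
    using graph unfolding graph_assumption_def by blast
  then obtain a b where ab: "(a, b) \<in> (\<Union>l\<in>{0..B - 1}. E ((t + k) + l))" "a \<in> heavy t k j"
    "b \<in> {1..n}" "b \<notin> heavy t k j"
    by (rule strongly_connected_leaves[OF _ assms(4) j v])
  then obtain l where l: "l \<le> B - 1" "(a, b) \<in> E (t + (k + l))"
    by (auto simp: add.assoc)
  have "a \<in> heavy t (k + l) j"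
    using ab(2) heavy_mono[OF t j, of k "k + l"] by auto
  then have "b \<in> heavy t (Suc (k + l)) j"
    using transition_step[OF t ab(3) _ j, of a "k + l"] l ab(3) by (auto simp: heavy_def)
  moreover have "Suc (k + l) \<le> k + B"
    using l B_pos by simp
  ultimately have "b \<in> heavy t (k + B) j"
    using heavy_mono[OF t j] by blast
  then show ?thesis
    using ab heavy_mono[OF t j, of k "k + B"] by auto
qed

text \<open>Initially \<open>j\<close> itself is heavy, and each block of \<open>B\<close> rounds
  adds at least one agent until all are heavy.\<close>

lemma card_heavy:
  assumes t: "1 \<le> t" and j: "j \<in> {1..n}"
  shows "min n (Suc k) \<le> card (heavy t (k * B) j)"
proof (induction k)
  case 0
  have "j \<in> heavy t 0 j"
    using j by (simp add: heavy_def)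
  then have "0 < card (heavy t 0 j)"
    by (auto simp: card_gt_0_iff heavy_def)
  then show ?case by simp
next
  case (Suc k)
  have fin: "finite (heavy t k' j)" for k'
    by (simp add: heavy_def)
  have j0: "j \<in> heavy t (k * B) j"
    using heavy_mono[OF t j, of 0 "k * B"] j by (auto simp: heavy_def)
  show ?case
  proof (cases "heavy t (k * B) j = {1..n}")
    case True
    then have "{1..n} \<subseteq> heavy t (Suc k * B) j"
      using heavy_mono[OF t j, of "k * B" "Suc k * B"] by auto
    from card_mono[OF fin this] show ?thesis by simp
  next
    case False
    have "card (heavy t (k * B) j) < card (heavy t (Suc k * B) j)"
      using heavy_grows[OF t j False j0] by (intro psubset_card_mono fin) (simp add: add.commute)
    then show ?thesis
      using Suc.IH by simp
  qed
qed

lemma transition_lower_bound: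
  assumes "1 \<le> t" "i \<in> {1..n}" "j \<in> {1..n}"
  shows "w ^ (n * B) \<le> transition n W t (n * B) i j"
proof -
  have "card {1..n} \<le> card (heavy t (n * B) j)"
    using card_heavy[OF assms(1,3), of n] by simp
  then have "heavy t (n * B) j = {1..n}"
    by (rule card_seteq[rotated 2]) (auto simp: heavy_def)
  then have "i \<in> heavy t (n * B) j"
    using assms(2) by simp
  then show ?thesis
    by (simp add: heavy_def)
qed

text \<open>Unrolling the perturbed averaging. Rows sum to one, so averaging does not amplify
  earlier perturbations and they merely add up.\<close>

lemma norm_transition_diff_le:
  fixes x :: "nat \<Rightarrow> nat \<Rightarrow> 'v::real_normed_vector"
  assumes perturbation: "\<And>t i. 1 \<le> t \<Longrightarrow> i \<in> {1..n} \<Longrightarrow>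
      norm (x i (Suc t) - (\<Sum>j=1..n. W t i j *\<^sub>R x j t)) \<le> e (Suc t)"
    and "1 \<le> t" "i \<in> {1..n}"
  shows "norm (x i (t + k) - (\<Sum>j=1..n. transition n W t k i j *\<^sub>R x j t)) \<le> (\<Sum>s<k. e (Suc (t + s)))"
  using assms(3)
proof (induction k arbitrary: i)
  case 0
  have "(\<Sum>j=1..n. transition n W t 0 i j *\<^sub>R x j t) = (\<Sum>j=1..n. if j = i then x j t else 0)"
    by (intro sum.cong) auto
  then show ?case
    using 0 by simp
next
  case (Suc k)
  let ?y = "\<lambda>l. \<Sum>j=1..n. transition n W t k l j *\<^sub>R x j t"
  have "(\<Sum>j=1..n. transition n W t (Suc k) i j *\<^sub>R x j t) = (\<Sum>l=1..n. W (t + k) i l *\<^sub>R ?y l)"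
    by (simp only: transition.simps scaleR_left.sum scaleR_right.sum scaleR_scaleR) (rule sum.swap)
  then have "norm (x i (t + Suc k) - (\<Sum>j=1..n. transition n W t (Suc k) i j *\<^sub>R x j t))
      = norm ((x i (Suc (t + k)) - (\<Sum>l=1..n. W (t + k) i l *\<^sub>R x l (t + k)))
        + (\<Sum>l=1..n. W (t + k) i l *\<^sub>R (x l (t + k) - ?y l)))"
    by (simp add: scaleR_diff_right sum_subtractf)
  also have "\<dots> \<le> e (Suc (t + k)) + (\<Sum>l=1..n. W (t + k) i l * (\<Sum>s<k. e (Suc (t + s))))"
  proof (rule norm_triangle_mono)
    show "norm (x i (Suc (t + k)) - (\<Sum>l=1..n. W (t + k) i l *\<^sub>R x l (t + k))) \<le> e (Suc (t + k))"
      using assms(2) Suc.prems by (intro perturbation) simp_all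
    show "norm (\<Sum>l=1..n. W (t + k) i l *\<^sub>R (x l (t + k) - ?y l))
        \<le> (\<Sum>l=1..n. W (t + k) i l * (\<Sum>s<k. e (Suc (t + s))))"
    proof (rule sum_norm_le)
      fix l assume l: "l \<in> {1..n}"
      have "0 \<le> W (t + k) i l"
        using assms(2) Suc.prems l by (intro W_nonneg) simp_all
      then have "norm (W (t + k) i l *\<^sub>R (x l (t + k) - ?y l)) = W (t + k) i l * norm (x l (t + k) - ?y l)"
        by (simp only: norm_scaleR abs_of_nonneg)
      also have "\<dots> \<le> W (t + k) i l * (\<Sum>s<k. e (Suc (t + s)))"
        by (rule mult_left_mono[OF Suc.IH[OF l]]) fact
      finally show "norm (W (t + k) i l *\<^sub>R (x l (t + k) - ?y l))
          \<le> W (t + k) i l * (\<Sum>s<k. e (Suc (t + s)))" .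
    qed
  qed
  also have "\<dots> = e (Suc (t + k)) + (\<Sum>s<k. e (Suc (t + s)))"
    using W_row[of "t + k" i] assms(2) Suc.prems
    by (simp del: One_nat_def flip: sum_distrib_right)
  finally show ?case
    by (simp only: sum.lessThan_Suc add.commute[of "e (Suc (t + k))"])
qed

section \<open>Contraction of the disagreement between the agents\<close>

definition diam :: "(nat \<Rightarrow> nat \<Rightarrow> 'v::real_normed_vector) \<Rightarrow> nat \<Rightarrow> real" where
  "diam x t = Max ((\<lambda>(i, j). norm (x i t - x j t)) ` ({1..n} \<times> {1..n}))"

lemma diam_ge: "i \<in> {1..n} \<Longrightarrow> j \<in> {1..n} \<Longrightarrow> norm (x i t - x j t) \<le> diam x t"
  unfolding diam_def by (rule Max_ge) force+

lemma diam_le: "(\<And>i j. i \<in> {1..n} \<Longrightarrow> j \<in> {1..n} \<Longrightarrow> norm (x i t - x j t) \<le> d) \<Longrightarrow> diam x t \<le> d"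
  unfolding diam_def using n_pos by (subst Max_le_iff) auto

lemma diam_nonneg: "0 \<le> diam x t"
  using diam_ge[of 1 1 x t] n_pos by simp

lemma norm_average_diff_le:
  assumes "1 \<le> t" "i \<in> {1..n}" "k \<in> {1..n}"
  shows "norm ((\<Sum>j=1..n. W t i j *\<^sub>R x j t) - x k t) \<le> diam x t"
proof -
  have "norm ((\<Sum>j=1..n. W t i j *\<^sub>R x j t) - x k t)
      = norm (\<Sum>j=1..n. W t i j *\<^sub>R (x j t - x k t))"
    using W_row[OF assms(1,2)]
    by (simp add: scaleR_diff_right sum_subtractf flip: scaleR_left.sum)
  also have "\<dots> \<le> (\<Sum>j=1..n. W t i j * diam x t)"
    using assms by (intro sum_norm_le) (simp add: W_nonneg mult_left_mono diam_ge)
  also have "\<dots> = diam x t"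
    using W_row[OF assms(1,2)] by (simp flip: sum_distrib_right)
  finally show ?thesis .
qed

lemma diam_contraction:
  fixes x :: "nat \<Rightarrow> nat \<Rightarrow> 'v::real_normed_vector"
  assumes perturbation: "\<And>t i. 1 \<le> t \<Longrightarrow> i \<in> {1..n} \<Longrightarrow>
      norm (x i (Suc t) - (\<Sum>j=1..n. W t i j *\<^sub>R x j t)) \<le> e (Suc t)"
    and t: "1 \<le> t"
  shows "diam x (t + n * B) \<le> (1 - (w ^ (n * B))\<^sup>2) * diam x t + 2 * (\<Sum>s<n * B. e (Suc (t + s)))"
proof (rule diam_le)
  fix i k assume ik: "i \<in> {1..n}" "k \<in> {1..n}"
  let ?y = "\<lambda>i. \<Sum>j=1..n. transition n W t (n * B) i j *\<^sub>R x j t"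
  let ?e = "\<Sum>s<n * B. e (Suc (t + s))"
  \<comment> \<open>Agent \<open>1\<close> serves as the index shared by the two rows. Both give it
    weight at least \<open>w ^ (n * B)\<close>, hence the square in the contraction factor.\<close>
  have "norm (?y i - ?y k) \<le> (1 - (w ^ (n * B))\<^sup>2) * diam x t"
    using t ik w n_pos
    by (intro norm_convex_combination_diff_le[where i = 1] weights_transition
        transition_lower_bound diam_ge) auto
  moreover have "norm (x i (t + n * B) - ?y i) \<le> ?e" "norm (x k (t + n * B) - ?y k) \<le> ?e"
    using norm_transition_diff_le[OF perturbation t] ik by blast+
  moreover have "norm (x i (t + n * B) - x k (t + n * B))
      \<le> norm (?y i - ?y k) + norm (x i (t + n * B) - ?y i) + norm (x k (t + n * B) - ?y k)"
    by norm
  ultimately show "norm (x i (t + n * B) - x k (t + n * B))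
      \<le> (1 - (w ^ (n * B))\<^sup>2) * diam x t + 2 * ?e"
    by linarith
qed

end

text \<open>Summing the recurrence reproduces \<open>1 - h\<close> times the sum of \<open>d\<close>
  on the right; moving this to the left leaves the factor \<open>h\<close>. Each perturbation is
  counted in at most \<open>L\<close> windows.\<close>

lemma sum_contraction_le:
  fixes d e :: "nat \<Rightarrow> real"
  assumes contr: "\<And>t. 1 \<le> t \<Longrightarrow> d (t + L) \<le> (1 - h) * d t + 2 * (\<Sum>s<L. e (Suc (t + s)))"
    and d: "\<And>t. 0 \<le> d t" "\<And>t. 1 \<le> t \<Longrightarrow> d t \<le> D" and e: "\<And>t. 0 \<le> e t" and h: "0 \<le> h" "h \<le> 1"
  shows "h * (\<Sum>t=1..T. d t) \<le> real L * D + 2 * real L * (\<Sum>t=1..T. e (Suc t))"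
proof -
  have D0: "0 \<le> D"
    using d(1)[of 1] d(2)[of 1] by simp
  \<comment> \<open>The recurrence controls \<open>d\<close> only after time \<open>L\<close>; the
    first \<open>L\<close> values are bounded by \<open>D\<close> each.\<close>
  have first: "(\<Sum>t=1..T'. d t) \<le> real L * D" if "T' \<le> L" for T'
  proof -
    have "(\<Sum>t=1..T'. d t) \<le> real (card {1..T'}) * D"
      using d by (intro sum_bounded_above) auto
    also have "\<dots> \<le> real L * D"
      using that D0 by (intro mult_right_mono) auto
    finally show ?thesis .
  qed
  show ?thesis
  proof (cases "T \<le> L")
    case True
    have "h * (\<Sum>t=1..T. d t) \<le> 1 * (\<Sum>t=1..T. d t)"
      using h d by (intro mult_right_mono sum_nonneg) auto
    also have "\<dots> \<le> real L * D"
      using first[OF True] by simp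
    finally show ?thesis
      using e by (simp add: add_increasing2 sum_nonneg)
  next
    case False
    then obtain T' where T: "T = L + T'"
      by (metis le_add_diff_inverse nat_le_linear)
    have "(\<Sum>t=1..T. d t) = (\<Sum>t=1..L. d t) + (\<Sum>t=1..T'. d (t + L))"
      using sum.ub_add_nat[of 1 L d T'] sum.shift_bounds_cl_nat_ivl[of d 1 L T']
      by (simp add: T add.commute)
    also have "\<dots> \<le> real L * D + (\<Sum>t=1..T'. (1 - h) * d t + 2 * (\<Sum>s<L. e (Suc (t + s))))"
      using first contr by (intro add_mono sum_mono) auto
    also have "\<dots> = real L * D + (1 - h) * (\<Sum>t=1..T'. d t)
        + 2 * (\<Sum>s<L. \<Sum>t=1..T'. e (Suc (t + s)))"
      by (simp add: sum.distrib flip: sum_distrib_left) (rule sum.swap)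
    also have "\<dots> \<le> real L * D + (1 - h) * (\<Sum>t=1..T. d t)
        + 2 * (\<Sum>s<L. \<Sum>t=1..T. e (Suc t))"
    proof (intro add_mono mult_left_mono sum_mono order_refl)
      show "(\<Sum>t=1..T'. d t) \<le> (\<Sum>t=1..T. d t)"
        using d T by (intro sum_mono2) auto
      \<comment> \<open>The shifted window \<open>1 + s..T' + s\<close> stays inside
        \<open>1..T\<close>, because \<open>s < L\<close> and \<open>T = L + T'\<close>.\<close>
      fix s assume s: "s \<in> {..<L}"
      have "(\<Sum>t=1..T'. e (Suc (t + s))) = (\<Sum>t=1 + s..T' + s. e (Suc t))"
        by (rule sum.shift_bounds_cl_nat_ivl[symmetric])
      also have "\<dots> \<le> (\<Sum>t=1..T. e (Suc t))"
        using s e T by (intro sum_mono2) auto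
      finally show "(\<Sum>t=1..T'. e (Suc (t + s))) \<le> (\<Sum>t=1..T. e (Suc t))" .
    qed (use h in auto)
    finally show ?thesis
      by (simp add: algebra_simps)
  qed
qed

section \<open>The one-step inequality\<close>

text \<open>Jensen's inequality uses the row sums; after exchanging the sums, the column sums remove
  the weights.\<close>

lemma (in network) sum_norm_average_le:
  fixes x :: "nat \<Rightarrow> 'v::real_inner"
  assumes "1 \<le> t"
  shows "(\<Sum>i=1..n. (norm ((\<Sum>j=1..n. W t i j *\<^sub>R x j) - y))\<^sup>2) \<le> (\<Sum>j=1..n. (norm (x j - y))\<^sup>2)"
proof -
  have jensen: "(norm ((\<Sum>j=1..n. W t i j *\<^sub>R x j) - y))\<^sup>2 \<le> (\<Sum>j=1..n. W t i j * (norm (x j - y))\<^sup>2)"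
    if i: "i \<in> {1..n}" for i
  proof -
    have "(\<Sum>j=1..n. W t i j *\<^sub>R x j) - y = (\<Sum>j=1..n. W t i j *\<^sub>R (x j - y))"
      using W_row[OF assms i] by (simp add: scaleR_diff_right sum_subtractf flip: scaleR_left.sum)
    then have "norm ((\<Sum>j=1..n. W t i j *\<^sub>R x j) - y) \<le> (\<Sum>j=1..n. norm (W t i j *\<^sub>R (x j - y)))"
      by (simp only: norm_sum)
    also have "\<dots> = (\<Sum>j=1..n. W t i j * norm (x j - y))"
      by (intro sum.cong) (simp_all add: W_nonneg[OF assms i] del: One_nat_def)
    finally have "(norm ((\<Sum>j=1..n. W t i j *\<^sub>R x j) - y))\<^sup>2 \<le> (\<Sum>j=1..n. W t i j * norm (x j - y))\<^sup>2"
      by (simp add: power_mono)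
    also have "\<dots> \<le> (\<Sum>j=1..n. W t i j * (norm (x j - y))\<^sup>2)"
      using convex_on_sum[OF _ _ convex_power2, of "{1..n}" "W t i" "\<lambda>j. norm (x j - y)"]
        W_row[OF assms i] W_nonneg[OF assms i] n_pos by simp
    finally show ?thesis .
  qed
  have "(\<Sum>i=1..n. (norm ((\<Sum>j=1..n. W t i j *\<^sub>R x j) - y))\<^sup>2)
      \<le> (\<Sum>i=1..n. \<Sum>j=1..n. W t i j * (norm (x j - y))\<^sup>2)"
    by (intro sum_mono jensen)
  also have "\<dots> = (\<Sum>j=1..n. \<Sum>i=1..n. W t i j * (norm (x j - y))\<^sup>2)"
    by (rule sum.swap)
  also have "\<dots> = (\<Sum>j=1..n. (norm (x j - y))\<^sup>2)"
    by (intro sum.cong) (simp_all add: W_column[OF assms] del: One_nat_def flip: sum_distrib_right)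
  finally show ?thesis .
qed

text \<open>Replacing \<open>1 / \<gamma> t\<close> by \<open>1 / \<gamma> (Suc t)\<close> in front
  of \<open>Q t\<close> would spoil the telescoping. The regularisation term with
  \<open>\<beta> (Suc t)\<close> pays for exactly this change.\<close>

lemma dual_telescope:
  fixes Q \<beta> \<gamma> :: "nat \<Rightarrow> real"
  assumes \<gamma>: "\<And>t. 1 \<le> t \<Longrightarrow> 0 < \<gamma> t" and Q: "\<And>t. 0 \<le> Q t"
    and step: "\<And>t. 1 \<le> t \<Longrightarrow> 1 / \<gamma> (Suc t) - 1 / \<gamma> t \<le> \<beta> (Suc t)"
  shows "Q (Suc T) / (2 * \<gamma> (Suc T)) - Q 1 / (2 * \<gamma> 1)
    \<le> (\<Sum>t=1..T. \<beta> (Suc t) / 2 * Q t + (Q (Suc t) - Q t) / (2 * \<gamma> (Suc t)))"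
proof (induction T)
  case (Suc T)
  have "Q (Suc T) / 2 * (1 / \<gamma> (Suc (Suc T)) - 1 / \<gamma> (Suc T)) \<le> Q (Suc T) / 2 * \<beta> (Suc (Suc T))"
    using step[of "Suc T"] Q[of "Suc T"] by (intro mult_left_mono) auto
  then have "Q (Suc (Suc T)) / (2 * \<gamma> (Suc (Suc T))) - Q (Suc T) / (2 * \<gamma> (Suc T))
      \<le> \<beta> (Suc (Suc T)) / 2 * Q (Suc T) + (Q (Suc (Suc T)) - Q (Suc T)) / (2 * \<gamma> (Suc (Suc T)))"
    by (simp add: algebra_simps diff_divide_distrib)
  then show ?case
    using Suc.IH by simp
qed simp

text \<open>Summation by parts: \<open>S t\<close> is left with half of
  \<open>1 / \<alpha> (Suc t) - 1 / \<alpha> t - \<mu>\<close> as coefficient. Only the positive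
  part of it costs anything, at most \<open>D / 2\<close> times its size.\<close>

lemma primal_telescope:
  fixes S \<alpha> :: "nat \<Rightarrow> real"
  assumes S: "\<And>t. 0 \<le> S t" "\<And>t. 1 \<le> t \<Longrightarrow> S t \<le> D"
  shows "(\<Sum>t=1..T. (S t - S (Suc t)) / (2 * \<alpha> (Suc t)) - \<mu> / 2 * S t)
    \<le> S 1 / (2 * \<alpha> 1) - S (Suc T) / (2 * \<alpha> (Suc T))
      + D / 2 * (\<Sum>t=1..T. max 0 (1 / \<alpha> (Suc t) - 1 / \<alpha> t - \<mu>))"
proof (induction T)
  case (Suc T)
  let ?h = "max 0 (1 / \<alpha> (Suc (Suc T)) - 1 / \<alpha> (Suc T) - \<mu>)"
  have "S (Suc T) / 2 * (1 / \<alpha> (Suc (Suc T)) - 1 / \<alpha> (Suc T) - \<mu>) \<le> S (Suc T) / 2 * ?h"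
    using S(1)[of "Suc T"] by (intro mult_left_mono) auto
  also have "\<dots> \<le> D / 2 * ?h"
    using S(2)[of "Suc T"] by (intro mult_right_mono) auto
  finally have "(S (Suc T) - S (Suc (Suc T))) / (2 * \<alpha> (Suc (Suc T))) - \<mu> / 2 * S (Suc T)
      \<le> S (Suc T) / (2 * \<alpha> (Suc T)) - S (Suc (Suc T)) / (2 * \<alpha> (Suc (Suc T))) + D / 2 * ?h"
    by (simp add: algebra_simps add_divide_distrib diff_divide_distrib)
  then show ?case
    using Suc.IH by (simp add: distrib_left)
qed simp

text \<open>The step sizes enter only through these inequalities, so powers of \<open>t\<close> are
  needed only for the final rates. \<open>H\<close> bounds, uniformly in \<open>T\<close>, the part
  of the growth of \<open>1 / \<alpha> t\<close> that strong convexity does not absorb.\<close>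

locale online_algorithm = network +
  fixes p :: nat and m :: "nat \<Rightarrow> nat" and X :: "rseq set" and r R :: real
    and f :: losses and g df :: vec_funs and dg :: jacobians and F1 F2 \<mu> :: real
    and \<alpha> \<beta> \<gamma> :: "nat \<Rightarrow> real" and x q :: "nat \<Rightarrow> nat \<Rightarrow> rseq" and H :: real
  assumes function_asm: "function_assumption p X r R n m f g df dg F1 F2"
    and strongly_convex: "strong_convexity_assumption X n f df \<mu>"
    and algorithm: "algorithm1 X n m g df dg W \<alpha> \<beta> \<gamma> x q"
    and \<alpha>_pos: "1 \<le> t \<Longrightarrow> 0 < \<alpha> t"
    and \<beta>_nonneg: "1 \<le> t \<Longrightarrow> 0 \<le> \<beta> t" and \<beta>_decreasing: "1 \<le> t \<Longrightarrow> \<beta> (Suc t) \<le> \<beta> t"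
    and \<gamma>_pos: "1 \<le> t \<Longrightarrow> 0 < \<gamma> t"
    and \<beta>\<gamma>: "1 \<le> t \<Longrightarrow> \<beta> (Suc t) * \<gamma> (Suc t) \<le> 1"
    and \<gamma>_step: "1 \<le> t \<Longrightarrow> 1 / \<gamma> (Suc t) - 1 / \<gamma> t \<le> \<beta> (Suc t)"
    and \<alpha>_step: "(\<Sum>t=1..T. max 0 (1 / \<alpha> (Suc t) - 1 / \<alpha> t - \<mu>)) \<le> H"
begin

definition G :: "nat \<Rightarrow> nat \<Rightarrow> nat \<Rightarrow> rseq" where
  "G i t = d_pos_part g dg i t (x i t)"

definition a :: "nat \<Rightarrow> nat \<Rightarrow> rseq" where
  "a i t = pos_part (g i t (x i t))"

text \<open>The clipped constraint linearised at the current state and evaluated at the next one; it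
  drives the dual update.\<close>

definition b :: "nat \<Rightarrow> nat \<Rightarrow> rseq" where
  "b i t = a i t + transpose_mat_vec (m i) (G i t) (x i (Suc t) - x i t)"

text \<open>Indexed by the round in which it is computed, \<open>z i t\<close> is the paper's \<open>z\<^bsub>i,t+1\<^esub>\<close>.\<close>

definition z :: "nat \<Rightarrow> nat \<Rightarrow> rseq" where
  "z i t = (\<Sum>j=1..n. W t i j *\<^sub>R x j t)"

text \<open>A uniform bound on \<open>b\<close>: \<open>F1\<close> for the clipped constraint, and
  \<open>F2\<close> times the diameter bound \<open>2 * R\<close> for the linear correction.\<close>

definition F :: real where
  "F = F1 + 2 * R * F2"

lemma X_convex: "convex X" and X_compact: "compact X" and X_sub: "X \<subseteq> cball 0 R \<inter> Rn p"
  and zero_in_X: "0 \<in> X" and R_nonneg: "0 \<le> R"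
  using function_asm compact_Rn_subset[of X R p]
  unfolding function_assumption_def by (auto simp: subset_iff)

lemma f_bound: "i \<in> {1..n} \<Longrightarrow> 1 \<le> t \<Longrightarrow> u \<in> X \<Longrightarrow> v \<in> X \<Longrightarrow> \<bar>f i t u - f i t v\<bar> \<le> F1"
  and g_Rn: "i \<in> {1..n} \<Longrightarrow> 1 \<le> t \<Longrightarrow> u \<in> X \<Longrightarrow> g i t u \<in> Rn (m i)"
  and g_bound: "i \<in> {1..n} \<Longrightarrow> 1 \<le> t \<Longrightarrow> u \<in> X \<Longrightarrow> norm (g i t u) \<le> F1"
  and df_bound: "i \<in> {1..n} \<Longrightarrow> 1 \<le> t \<Longrightarrow> u \<in> X \<Longrightarrow> norm (df i t u) \<le> F2"
  and dg_bound: "i \<in> {1..n} \<Longrightarrow> 1 \<le> t \<Longrightarrow> u \<in> X \<Longrightarrow> mat_norm (m i) (dg i t u) \<le> F2"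
  using function_asm unfolding function_assumption_def by blast+

lemma f_subgradient:
  "i \<in> {1..n} \<Longrightarrow> 1 \<le> t \<Longrightarrow> u \<in> X \<Longrightarrow> v \<in> X \<Longrightarrow> f i t u + inner (v - u) (df i t u) \<le> f i t v"
  using function_asm unfolding function_assumption_def is_subgradient_def by blast

lemma g_subgradient:
  "i \<in> {1..n} \<Longrightarrow> 1 \<le> t \<Longrightarrow> u \<in> X \<Longrightarrow> v \<in> X \<Longrightarrow> k < m i \<Longrightarrow>
    coord (g i t u) k + inner (v - u) (dg i t u k) \<le> coord (g i t v) k"
  using function_asm unfolding function_assumption_def is_subgradient_def by blast

lemma f_strongly_convex:
  "i \<in> {1..n} \<Longrightarrow> 1 \<le> t \<Longrightarrow> u \<in> X \<Longrightarrow> v \<in> X \<Longrightarrow>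
    f i t u + inner (v - u) (df i t u) + \<mu> / 2 * (norm (v - u))\<^sup>2 \<le> f i t v"
  using strongly_convex unfolding strong_convexity_assumption_def by blast

lemma F1_nonneg: "0 \<le> F1" and F2_nonneg: "0 \<le> F2"
  using n_pos f_bound[of 1 1 0 0] order_trans[OF norm_ge_zero df_bound[of 1 1 0]] zero_in_X by auto

lemma F_nonneg: "0 \<le> F"
  unfolding F_def using F1_nonneg F2_nonneg R_nonneg by simp

lemma norm_diff_X:
  assumes "u \<in> X" "v \<in> X"
  shows "norm (u - v) \<le> 2 * R"
proof -
  have "norm u \<le> R" "norm v \<le> R"
    using X_sub assms by auto
  then show ?thesis
    using norm_triangle_ineq4[of u v] by simp
qed

lemma x_step:
  "i \<in> {1..n} \<Longrightarrow> 1 \<le> t \<Longrightarrow>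
    x i (Suc t) = proj_onto X (z i t - \<alpha> (Suc t) *\<^sub>R (df i t (x i t) + mat_vec (m i) (G i t) (q i t)))"
  and q_step:
  "i \<in> {1..n} \<Longrightarrow> 1 \<le> t \<Longrightarrow>
    q i (Suc t) = pos_part ((1 - \<beta> (Suc t) * \<gamma> (Suc t)) *\<^sub>R q i t + \<gamma> (Suc t) *\<^sub>R b i t)"
  using algorithm unfolding algorithm1_def Let_def z_def G_def b_def a_def Suc_eq_plus1 by blast+

lemma x_first: "i \<in> {1..n} \<Longrightarrow> x i 1 \<in> X" and q_first: "i \<in> {1..n} \<Longrightarrow> q i 1 = 0"
  using algorithm unfolding algorithm1_def by blast+

lemma x_in_X:
  assumes "i \<in> {1..n}" "1 \<le> t"
  shows "x i t \<in> X"
  using assms(2)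
proof (induction t rule: dec_induct)
  case base
  show ?case by (rule x_first[OF assms(1)])
next
  case (step t)
  show ?case
    using x_step[OF assms(1)] step proj_onto_closest(1)[OF X_compact] zero_in_X by auto
qed

lemma q_nonneg:
  assumes "i \<in> {1..n}" "1 \<le> t"
  shows "0 \<le> coord (q i t) k"
proof (cases "t = 1")
  case True
  then show ?thesis using q_first[OF assms(1)] by (simp add: coord_zero)
next
  case False
  then obtain s where "t = Suc s" "1 \<le> s"
    using assms(2) by (cases t) auto
  then show ?thesis
    using q_step[OF assms(1)] by (simp add: coord_pos_part)
qed

lemma norm_G_le: "i \<in> {1..n} \<Longrightarrow> 1 \<le> t \<Longrightarrow> norm (mat_vec (m i) (G i t) v) \<le> F2 * norm v"
  unfolding G_def by (intro norm_mat_vec_d_pos_part_le dg_bound x_in_X)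

lemma norm_G_transpose_le:
  "i \<in> {1..n} \<Longrightarrow> 1 \<le> t \<Longrightarrow> norm (transpose_mat_vec (m i) (G i t) v) \<le> F2 * norm v"
  by (intro norm_transpose_mat_vec_le norm_G_le)

lemma norm_b_le:
  assumes "i \<in> {1..n}" "1 \<le> t"
  shows "norm (b i t) \<le> F"
proof -
  have "norm (b i t) \<le> norm (a i t) + norm (transpose_mat_vec (m i) (G i t) (x i (Suc t) - x i t))"
    unfolding b_def by (rule norm_triangle_ineq)
  also have "\<dots> \<le> F1 + F2 * (2 * R)"
  proof (rule add_mono)
    show "norm (a i t) \<le> F1"
      unfolding a_def using assms g_bound x_in_X norm_pos_part_le order_trans by blast
    have "norm (transpose_mat_vec (m i) (G i t) (x i (Suc t) - x i t)) \<le> F2 * norm (x i (Suc t) - x i t)"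
      by (rule norm_G_transpose_le[OF assms])
    also have "\<dots> \<le> F2 * (2 * R)"
      using assms by (intro mult_left_mono norm_diff_X x_in_X F2_nonneg) auto
    finally show "norm (transpose_mat_vec (m i) (G i t) (x i (Suc t) - x i t)) \<le> F2 * (2 * R)" .
  qed
  finally show ?thesis
    by (simp add: F_def mult_ac)
qed

text \<open>By induction, since \<open>\<beta>\<close> does not increase: the update bounds
  \<open>\<beta> (Suc t) * norm (q i (Suc t))\<close> by a convex combination, with weight
  \<open>\<beta> (Suc t) * \<gamma> (Suc t)\<close>, of quantities that are at most
  \<open>F\<close>.\<close>

lemma dual_bound:
  assumes i: "i \<in> {1..n}" and "1 \<le> t"
  shows "\<beta> t * norm (q i t) \<le> F"
  using assms(2)
proof (induction t rule: dec_induct)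
  case base
  show ?case using q_first[OF i] F_nonneg by simp
next
  case (step t)
  let ?\<beta> = "\<beta> (Suc t)" and ?\<gamma> = "\<gamma> (Suc t)"
  have t: "1 \<le> t" using step by simp
  have nn: "0 \<le> ?\<beta>" "0 < ?\<gamma>" "?\<beta> * ?\<gamma> \<le> 1"
    using \<beta>_nonneg \<gamma>_pos \<beta>\<gamma>[OF t] by auto
  have "norm (q i (Suc t)) \<le> norm ((1 - ?\<beta> * ?\<gamma>) *\<^sub>R q i t + ?\<gamma> *\<^sub>R b i t)"
    unfolding q_step[OF i t] by (rule norm_pos_part_le)
  also have "\<dots> \<le> (1 - ?\<beta> * ?\<gamma>) * norm (q i t) + ?\<gamma> * norm (b i t)"
    using nn by (intro norm_triangle_le) simp
  also have "\<dots> \<le> (1 - ?\<beta> * ?\<gamma>) * norm (q i t) + ?\<gamma> * F"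
    using nn norm_b_le[OF i t] by simp
  finally have "?\<beta> * norm (q i (Suc t)) \<le> ?\<beta> * ((1 - ?\<beta> * ?\<gamma>) * norm (q i t) + ?\<gamma> * F)"
    using nn by (intro mult_left_mono) auto
  also have "\<dots> = (1 - ?\<beta> * ?\<gamma>) * (?\<beta> * norm (q i t)) + ?\<beta> * ?\<gamma> * F"
    by (simp add: algebra_simps)
  also have "\<dots> \<le> (1 - ?\<beta> * ?\<gamma>) * F + ?\<beta> * ?\<gamma> * F"
  proof (intro add_right_mono mult_left_mono)
    have "?\<beta> * norm (q i t) \<le> \<beta> t * norm (q i t)"
      using \<beta>_decreasing[OF t] by (intro mult_right_mono) auto
    then show "?\<beta> * norm (q i t) \<le> F"
      using step.IH by simp
  qed (use nn in simp)
  finally show ?case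
    by (simp add: algebra_simps)
qed

text \<open>Clipping at zero does not increase the distance to a non-negative \<open>u\<close>, so
  the square of the unclipped step can be expanded. Its direction has norm at most
  \<open>2 * F\<close>, one \<open>F\<close> from \<open>b\<close> and one from the regularisation
  by \<open>dual_bound\<close>.\<close>

lemma dual_step:
  assumes i: "i \<in> {1..n}" and t: "1 \<le> t" and u: "\<And>k. 0 \<le> coord u k"
  shows "((norm (q i (Suc t) - u))\<^sup>2 - (norm (q i t - u))\<^sup>2) / (2 * \<gamma> (Suc t))
    \<le> inner (q i t - u) (b i t) - \<beta> (Suc t) / 2 * ((norm (q i t - u))\<^sup>2 - (norm u)\<^sup>2)
      + 2 * \<gamma> (Suc t) * F\<^sup>2"
proof -
  let ?\<beta> = "\<beta> (Suc t)" and ?\<gamma> = "\<gamma> (Suc t)" and ?q = "q i t" and ?b = "b i t"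
  let ?d = "?b - ?\<beta> *\<^sub>R ?q"
  have nn: "0 \<le> ?\<beta>" "0 < ?\<gamma>"
    using \<beta>_nonneg \<gamma>_pos by auto
  have "?\<beta> * norm ?q \<le> \<beta> t * norm ?q"
    using \<beta>_decreasing[OF t] by (intro mult_right_mono) auto
  then have "?\<beta> * norm ?q \<le> F"
    using dual_bound[OF i t] by simp
  then have "norm ?d \<le> F + F"
    using norm_b_le[OF i t] norm_triangle_ineq4[of ?b "?\<beta> *\<^sub>R ?q"] nn by simp
  then have d: "(norm ?d)\<^sup>2 \<le> (2 * F)\<^sup>2"
    by (intro power_mono) auto
  have "norm (q i (Suc t) - u) \<le> norm ((1 - ?\<beta> * ?\<gamma>) *\<^sub>R ?q + ?\<gamma> *\<^sub>R ?b - u)"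
    unfolding q_step[OF i t] by (intro norm_pos_part_diff_le u)
  also have "(1 - ?\<beta> * ?\<gamma>) *\<^sub>R ?q + ?\<gamma> *\<^sub>R ?b - u = (?q - u) + ?\<gamma> *\<^sub>R ?d"
    by (simp add: algebra_simps)
  finally have "(norm (q i (Suc t) - u))\<^sup>2 \<le> (norm ((?q - u) + ?\<gamma> *\<^sub>R ?d))\<^sup>2"
    by (intro power_mono) auto
  also have "\<dots> = (norm (?q - u))\<^sup>2 + 2 * ?\<gamma> * inner (?q - u) ?d + ?\<gamma>\<^sup>2 * (norm ?d)\<^sup>2"
    unfolding power2_norm_eq_inner
    by (simp add: inner_add_left inner_add_right inner_commute power2_eq_square)
  also have "\<dots> \<le> (norm (?q - u))\<^sup>2 + 2 * ?\<gamma> * inner (?q - u) ?d + ?\<gamma>\<^sup>2 * (2 * F)\<^sup>2"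
    using d by (intro add_left_mono mult_left_mono) auto
  finally have "((norm (q i (Suc t) - u))\<^sup>2 - (norm (?q - u))\<^sup>2) / (2 * ?\<gamma>)
      \<le> (2 * ?\<gamma> * inner (?q - u) ?d + ?\<gamma>\<^sup>2 * (2 * F)\<^sup>2) / (2 * ?\<gamma>)"
    using nn by (intro divide_right_mono) auto
  also have "\<dots> = inner (?q - u) ?d + 2 * ?\<gamma> * F\<^sup>2"
    using nn by (simp add: field_simps power2_eq_square)
  \<comment> \<open>Polarisation of \<open>inner (q - u) q\<close>, with the non-negative square of
    \<open>q\<close> dropped, yields the quadratic term that later pays for the growth of
    \<open>1 / \<gamma> t\<close>.\<close>
  also have "inner (?q - u) ?d \<le> inner (?q - u) ?b - ?\<beta> / 2 * ((norm (?q - u))\<^sup>2 - (norm u)\<^sup>2)"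
  proof -
    have "2 * inner (?q - u) ?q = (norm (?q - u))\<^sup>2 - (norm u)\<^sup>2 + (norm ?q)\<^sup>2"
      by (simp add: power2_norm_eq_inner inner_diff_left inner_diff_right inner_commute)
    then have "(norm (?q - u))\<^sup>2 - (norm u)\<^sup>2 \<le> 2 * inner (?q - u) ?q"
      by simp
    then have "?\<beta> / 2 * ((norm (?q - u))\<^sup>2 - (norm u)\<^sup>2) \<le> ?\<beta> / 2 * (2 * inner (?q - u) ?q)"
      using nn by (intro mult_left_mono) auto
    then show ?thesis
      by (simp add: inner_diff_right)
  qed
  finally show ?thesis
    by simp
qed

definition feasible :: "nat \<Rightarrow> rseq \<Rightarrow> bool" where
  "feasible t y \<longleftrightarrow> y \<in> X \<and> (\<forall>i\<in>{1..n}. \<forall>k<m i. coord (g i t y) k \<le> 0)"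

text \<open>Coordinatewise, \<open>a\<close> is at most the inner product of its column with
  \<open>x i t - y\<close>: both sides vanish for an inactive constraint, and otherwise the
  subgradient inequality applies with a non-positive value at \<open>y\<close>. Non-negativity of
  \<open>q\<close> allows summing with weights \<open>q\<close>.\<close>

lemma inner_q_a_le:
  assumes i: "i \<in> {1..n}" and t: "1 \<le> t" and y: "feasible t y"
  shows "inner (q i t) (a i t) \<le> inner (mat_vec (m i) (G i t) (q i t)) (x i t - y)"
proof -
  have X: "x i t \<in> X" "y \<in> X"
    using x_in_X i t y by (auto simp: feasible_def)
  have "inner (q i t) (a i t) = inner (a i t) (q i t)"
    by (rule inner_commute)
  also have "\<dots> = (\<Sum>k<m i. coord (a i t) k * coord (q i t) k)"
    unfolding a_def by (intro inner_Rn Rn_pos_part g_Rn i t X)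
  also have "\<dots> \<le> (\<Sum>k<m i. coord (q i t) k * inner (G i t k) (x i t - y))"
  proof (rule sum_mono)
    fix k assume "k \<in> {..<m i}"
    then have k: "k < m i" by simp
    have "coord (a i t) k \<le> inner (G i t k) (x i t - y)"
      using g_subgradient[OF i t X k] y i k
      by (auto simp: a_def G_def d_pos_part_def coord_pos_part feasible_def inner_commute
          inner_diff_right algebra_simps) force
    then show "coord (a i t) k * coord (q i t) k \<le> coord (q i t) k * inner (G i t k) (x i t - y)"
      using q_nonneg[OF i t] by (subst mult.commute) (intro mult_left_mono)
  qed
  also have "\<dots> = inner (mat_vec (m i) (G i t) (q i t)) (x i t - y)"
    by (simp add: mat_vec_def inner_sum_left)
  finally show ?thesis .
qed

text \<open>The inner product of the search direction with \<open>x i (Suc t) - y\<close> is split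
  at \<open>x i t\<close>. By adjointness the movement part of the constraint term completes
  \<open>inner (q i t) (a i t)\<close> to \<open>inner (q i t) (b i t)\<close>, the form that the
  dual step cancels.\<close>

lemma primal_step:
  assumes i: "i \<in> {1..n}" and t: "1 \<le> t" and y: "feasible t y"
  shows "inner (q i t) (b i t) + f i t (x i t) - f i t y + \<mu> / 2 * (norm (x i t - y))\<^sup>2
    \<le> ((norm (z i t - y))\<^sup>2 - (norm (x i (Suc t) - y))\<^sup>2 - (norm (x i (Suc t) - z i t))\<^sup>2) / (2 * \<alpha> (Suc t))
      + F2 * norm (x i (Suc t) - x i t)"
proof -
  let ?G = "mat_vec (m i) (G i t) (q i t)" and ?d = "df i t (x i t)"
    and ?x = "x i t" and ?x' = "x i (Suc t)" and ?\<alpha> = "\<alpha> (Suc t)"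
  have X: "?x \<in> X" "y \<in> X"
    using x_in_X i t y by (auto simp: feasible_def)
  have \<alpha>: "0 < ?\<alpha>"
    using \<alpha>_pos by simp
  have "inner (?d + ?G) (?x' - y)
      \<le> ((norm (z i t - y))\<^sup>2 - (norm (?x' - y))\<^sup>2 - (norm (?x' - z i t))\<^sup>2) / (2 * ?\<alpha>)"
    using proj_onto_step[OF X_compact X_convex X(2), of ?\<alpha> "?d + ?G" "z i t"] \<alpha>
    unfolding x_step[OF i t, symmetric] by (simp add: field_simps)
  moreover have "inner (?d + ?G) (?x' - y)
      = inner ?G (?x' - ?x) + inner ?G (?x - y) + inner ?d (?x - y) + inner ?d (?x' - ?x)"
    by (simp add: inner_add_left inner_diff_right)
  moreover have "inner (q i t) (b i t) = inner (q i t) (a i t) + inner ?G (?x' - ?x)"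
    by (simp add: b_def inner_add_right inner_mat_vec)
  moreover have "inner (q i t) (a i t) \<le> inner ?G (?x - y)"
    by (rule inner_q_a_le[OF i t y])
  moreover have "f i t ?x - f i t y + \<mu> / 2 * (norm (?x - y))\<^sup>2 \<le> inner ?d (?x - y)"
    using f_strongly_convex[OF i t X]
    by (simp add: norm_minus_commute inner_diff_right inner_diff_left inner_commute)
  moreover have "- (F2 * norm (?x' - ?x)) \<le> inner ?d (?x' - ?x)"
  proof -
    have "\<bar>inner ?d (?x' - ?x)\<bar> \<le> norm ?d * norm (?x' - ?x)"
      by (rule Cauchy_Schwarz_ineq2)
    also have "\<dots> \<le> F2 * norm (?x' - ?x)"
      using df_bound[OF i t X(1)] by (intro mult_right_mono) auto
    finally show ?thesis by linarith
  qed
  ultimately show ?thesis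
    by linarith
qed

text \<open>Adding the primal and dual steps leaves \<open>inner u (b i t)\<close>, which differs
  from \<open>inner u (a i t)\<close> by at most \<open>F2 * norm u\<close> times the
  movement.\<close>

lemma agent_step:
  assumes i: "i \<in> {1..n}" and t: "1 \<le> t" and y: "feasible t y" and u: "\<And>k. 0 \<le> coord u k"
  shows "f i t (x i t) - f i t y + \<mu> / 2 * (norm (x i t - y))\<^sup>2 + inner u (a i t)
      + (norm (x i (Suc t) - z i t))\<^sup>2 / (2 * \<alpha> (Suc t))
      + (\<beta> (Suc t) / 2 * (norm (q i t - u))\<^sup>2
          + ((norm (q i (Suc t) - u))\<^sup>2 - (norm (q i t - u))\<^sup>2) / (2 * \<gamma> (Suc t)))
    \<le> ((norm (z i t - y))\<^sup>2 - (norm (x i (Suc t) - y))\<^sup>2) / (2 * \<alpha> (Suc t))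
      + F2 * (1 + norm u) * norm (x i (Suc t) - x i t)
      + \<beta> (Suc t) / 2 * (norm u)\<^sup>2 + 2 * \<gamma> (Suc t) * F\<^sup>2"
proof -
  let ?d = "x i (Suc t) - x i t"
  have "inner u (a i t) - norm u * (F2 * norm ?d) \<le> inner u (b i t)"
  proof -
    have "\<bar>inner u (transpose_mat_vec (m i) (G i t) ?d)\<bar>
        \<le> norm u * norm (transpose_mat_vec (m i) (G i t) ?d)"
      by (rule Cauchy_Schwarz_ineq2)
    also have "\<dots> \<le> norm u * (F2 * norm ?d)"
      by (intro mult_left_mono norm_G_transpose_le i t) auto
    finally show ?thesis
      by (simp add: b_def inner_add_right)
  qed
  then show ?thesis
    using primal_step[OF i t y] dual_step[OF i t u]
    by (simp add: inner_diff_left add_divide_distrib diff_divide_distrib algebra_simps)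
qed

end

section \<open>Cumulative bounds\<close>

text \<open>Non-negativity of the square of \<open>e - \<alpha> * k\<close>, divided by
  \<open>2 * \<alpha>\<close>.\<close>

lemma young_scaled:
  fixes \<alpha> k e :: real
  assumes "0 < \<alpha>"
  shows "k * e \<le> e\<^sup>2 / (2 * \<alpha>) + \<alpha> / 2 * k\<^sup>2"
proof -
  have "0 \<le> (e - \<alpha> * k)\<^sup>2 / (2 * \<alpha>)"
    using assms by simp
  also have "\<dots> = e\<^sup>2 / (2 * \<alpha>) + \<alpha> / 2 * k\<^sup>2 - k * e"
    using assms by (simp add: field_simps power2_eq_square)
  finally show ?thesis by simp
qed

text \<open>Since \<open>n B\<close> rounds shrink the diameter of the states by the factor \<open>1 - (w\<^bsup>n B\<^esup>)\<^sup>2\<close>, the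
  diameters sum up to at most this multiple of the initial radius and the perturbations.\<close>

definition mixing :: "nat \<Rightarrow> nat \<Rightarrow> real \<Rightarrow> real" where
  "mixing n B w = 2 * real (n * B) / (w ^ (n * B))\<^sup>2"

text \<open>The cost per unit of total projection error, once disagreement is bounded by
  \<open>mixing\<close>. The factor \<open>2\<close> covers the disagreement in the movement and
  that from comparing losses and constraints at different agents.\<close>

definition drift :: "nat \<Rightarrow> nat \<Rightarrow> nat \<Rightarrow> real \<Rightarrow> real \<Rightarrow> real" where
  "drift n M B w F2 = F2 * (1 + real M) * (1 + 2 * real n * mixing n B w)"

context online_algorithm
begin

definition err :: "nat \<Rightarrow> nat \<Rightarrow> real" where
  "err i t = norm (x i (Suc t) - z i t)"

text \<open>The total error of one round. The shift of the index makes \<open>pert (Suc t)\<close>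
  the error made in passing from \<open>t\<close> to \<open>Suc t\<close>, as the contraction lemmas
  expect.\<close>

definition pert :: "nat \<Rightarrow> real" where
  "pert t = (\<Sum>i=1..n. norm (x i t - z i (t - 1)))"

lemma pert_Suc: "pert (Suc t) = (\<Sum>i=1..n. err i t)"
  by (simp add: pert_def err_def)

lemma pert_nonneg: "0 \<le> pert t"
  unfolding pert_def by (intro sum_nonneg) auto

lemma x_perturbation:
  assumes "i \<in> {1..n}"
  shows "norm (x i (Suc t) - (\<Sum>j=1..n. W t i j *\<^sub>R x j t)) \<le> pert (Suc t)"
proof -
  have "norm (x i (Suc t) - z i t) \<le> (\<Sum>i=1..n. norm (x i (Suc t) - z i t))"
    using assms by (intro member_le_sum) auto
  then show ?thesis
    by (simp add: pert_def z_def)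
qed

lemma mixing_nonneg: "0 \<le> mixing n B w"
  unfolding mixing_def by simp

lemma sum_diam_le: "(\<Sum>t=1..T. diam x t) \<le> mixing n B w * (R + (\<Sum>t=1..T. pert (Suc t)))"
proof -
  let ?h = "(w ^ (n * B))\<^sup>2"
  have h: "0 < ?h" "?h \<le> 1"
    using w by (auto simp: power_le_one)
  have "?h * (\<Sum>t=1..T. diam x t) \<le> real (n * B) * (2 * R) + 2 * real (n * B) * (\<Sum>t=1..T. pert (Suc t))"
    using h by (intro sum_contraction_le diam_contraction x_perturbation diam_nonneg pert_nonneg diam_le norm_diff_X x_in_X) auto
  then show ?thesis
    using h by (simp add: mixing_def field_simps)
qed

lemma norm_move_le:
  assumes "i \<in> {1..n}" "1 \<le> t"
  shows "norm (x i (Suc t) - x i t) \<le> err i t + diam x t"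
  using norm_average_diff_le[OF assms(2,1,1), of x] norm_triangle_ineq[of "x i (Suc t) - z i t" "z i t - x i t"]
  by (simp add: err_def z_def)

text \<open>A constant dual vector serves all agents: pairing it with a non-negative vector gives
  \<open>s\<close> times the l1 norm, which dominates \<open>s\<close> times the Euclidean
  norm.\<close>

definition weight :: "nat \<Rightarrow> real \<Rightarrow> rseq" where
  "weight i s = vec_of (m i) (\<lambda>_. s)"

lemma weight_inner:
  assumes "0 \<le> s" "i \<in> {1..n}" "1 \<le> t"
  shows "s * norm (a i t) \<le> inner (weight i s) (a i t)"
proof -
  have "a i t \<in> Rn (m i)"
    unfolding a_def by (intro Rn_pos_part g_Rn x_in_X assms)
  then have "norm (a i t) \<le> (\<Sum>k<m i. coord (a i t) k)"
    using norm_le_sum_coord[of "a i t" "m i"] by (simp add: a_def coord_pos_part)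
  then have "s * norm (a i t) \<le> s * (\<Sum>k<m i. coord (a i t) k)"
    using assms by (intro mult_left_mono)
  also have "\<dots> = inner (weight i s) (a i t)"
    by (simp add: weight_def inner_Rn[of _ "m i"] coord_vec_of sum_distrib_left)
  finally show ?thesis .
qed

lemma norm_weight_le:
  assumes "0 \<le> s" "i \<in> {1..n}"
  shows "norm (weight i s) \<le> real (\<Sum>i=1..n. m i) * s"
proof -
  have "m i \<le> (\<Sum>i=1..n. m i)"
    using assms by (intro member_le_sum) auto
  \<comment> \<open>For a natural number \<open>m i\<close>, this replaces the square root of
    \<open>m i\<close> by the total dimension.\<close>
  moreover have "real (m i) \<le> (real (m i))\<^sup>2"
    by (cases "m i") (auto simp: power2_eq_square)
  ultimately have "real (m i) \<le> (real (\<Sum>i=1..n. m i))\<^sup>2"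
    by (meson of_nat_0_le_iff of_nat_mono order_trans power_mono)
  then have "(norm (weight i s))\<^sup>2 \<le> (real (\<Sum>i=1..n. m i) * s)\<^sup>2"
    unfolding weight_def norm_vec_of_const power_mult_distrib by (intro mult_right_mono) auto
  moreover have "0 \<le> real (\<Sum>i=1..n. m i) * s"
    using assms(1) by (intro mult_nonneg_nonneg of_nat_0_le_iff)
  ultimately show ?thesis
    by (rule power2_le_imp_le)
qed

lemma round_bound:
  assumes t: "1 \<le> t" and y: "feasible t y" and s: "0 \<le> s"
  defines "M \<equiv> \<Sum>i=1..n. m i"
  shows "(\<Sum>i=1..n. f i t (x i t) - f i t y) + s * (\<Sum>i=1..n. norm (a i t))
      + (\<Sum>i=1..n. (err i t)\<^sup>2 / (2 * \<alpha> (Suc t)))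
      + (\<Sum>i=1..n. \<beta> (Suc t) / 2 * (norm (q i t - weight i s))\<^sup>2
          + ((norm (q i (Suc t) - weight i s))\<^sup>2 - (norm (q i t - weight i s))\<^sup>2) / (2 * \<gamma> (Suc t)))
    \<le> (((\<Sum>i=1..n. (norm (x i t - y))\<^sup>2) - (\<Sum>i=1..n. (norm (x i (Suc t) - y))\<^sup>2)) / (2 * \<alpha> (Suc t))
        - \<mu> / 2 * (\<Sum>i=1..n. (norm (x i t - y))\<^sup>2))
      + F2 * (1 + real M * s) * (pert (Suc t) + real n * diam x t)
      + real M * s\<^sup>2 / 2 * \<beta> (Suc t) + 2 * real n * F\<^sup>2 * \<gamma> (Suc t)"
proof -
  let ?D = "\<lambda>i. \<beta> (Suc t) / 2 * (norm (q i t - weight i s))\<^sup>2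
          + ((norm (q i (Suc t) - weight i s))\<^sup>2 - (norm (q i t - weight i s))\<^sup>2) / (2 * \<gamma> (Suc t))"
  have \<alpha>: "0 < \<alpha> (Suc t)"
    using \<alpha>_pos by simp
  have agent: "(f i t (x i t) - f i t y) + s * norm (a i t) + (err i t)\<^sup>2 / (2 * \<alpha> (Suc t)) + ?D i
      \<le> ((norm (z i t - y))\<^sup>2 - (norm (x i (Suc t) - y))\<^sup>2) / (2 * \<alpha> (Suc t))
        - \<mu> / 2 * (norm (x i t - y))\<^sup>2
        + F2 * (1 + real M * s) * (err i t + diam x t)
        + (s\<^sup>2 / 2 * \<beta> (Suc t)) * real (m i) + 2 * F\<^sup>2 * \<gamma> (Suc t)"
    if i: "i \<in> {1..n}" for i
  proof -
    have "norm (weight i s) \<le> real M * s"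
      unfolding M_def by (rule norm_weight_le[OF s i])
    then have "F2 * (1 + norm (weight i s)) * norm (x i (Suc t) - x i t)
        \<le> F2 * (1 + real M * s) * (err i t + diam x t)"
      using F2_nonneg s by (intro mult_mono add_mono norm_move_le i t) auto
    moreover have "0 \<le> coord (weight i s) k" for k
      using s by (simp add: weight_def coord_vec_of)
    note agent_step[OF i t y this, folded err_def]
    moreover have "\<beta> (Suc t) / 2 * (norm (weight i s))\<^sup>2 = (s\<^sup>2 / 2 * \<beta> (Suc t)) * real (m i)"
      by (simp add: weight_def norm_vec_of_const)
    ultimately show ?thesis
      using weight_inner[OF s i t] mult.commute[of "\<gamma> (Suc t)" "F\<^sup>2"] by linarith
  qed
  have "(\<Sum>i=1..n. f i t (x i t) - f i t y) + s * (\<Sum>i=1..n. norm (a i t))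
      + (\<Sum>i=1..n. (err i t)\<^sup>2 / (2 * \<alpha> (Suc t))) + (\<Sum>i=1..n. ?D i)
    = (\<Sum>i=1..n. (f i t (x i t) - f i t y) + s * norm (a i t) + (err i t)\<^sup>2 / (2 * \<alpha> (Suc t)) + ?D i)"
    by (simp only: sum.distrib sum_distrib_left)
  also have "\<dots> \<le> (\<Sum>i=1..n. ((norm (z i t - y))\<^sup>2 - (norm (x i (Suc t) - y))\<^sup>2) / (2 * \<alpha> (Suc t))
        - \<mu> / 2 * (norm (x i t - y))\<^sup>2
        + F2 * (1 + real M * s) * (err i t + diam x t)
        + (s\<^sup>2 / 2 * \<beta> (Suc t)) * real (m i) + 2 * F\<^sup>2 * \<gamma> (Suc t))"
    by (intro sum_mono agent)
  also have "\<dots> = ((\<Sum>i=1..n. (norm (z i t - y))\<^sup>2) - (\<Sum>i=1..n. (norm (x i (Suc t) - y))\<^sup>2)) / (2 * \<alpha> (Suc t))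
        - \<mu> / 2 * (\<Sum>i=1..n. (norm (x i t - y))\<^sup>2)
        + F2 * (1 + real M * s) * (pert (Suc t) + real n * diam x t)
        + (s\<^sup>2 / 2 * \<beta> (Suc t)) * real M + real n * (2 * F\<^sup>2 * \<gamma> (Suc t))"
    by (simp add: sum.distrib sum_subtractf pert_Suc M_def
        flip: sum_distrib_left sum_divide_distrib)
  \<comment> \<open>Doubly stochastic averaging does not increase the total squared distance to
    \<open>y\<close>, so \<open>z\<close> may be replaced by \<open>x\<close>.\<close>
  also have "\<dots> \<le> ((\<Sum>i=1..n. (norm (x i t - y))\<^sup>2) - (\<Sum>i=1..n. (norm (x i (Suc t) - y))\<^sup>2)) / (2 * \<alpha> (Suc t))
        - \<mu> / 2 * (\<Sum>i=1..n. (norm (x i t - y))\<^sup>2)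
        + F2 * (1 + real M * s) * (pert (Suc t) + real n * diam x t)
        + (s\<^sup>2 / 2 * \<beta> (Suc t)) * real M + real n * (2 * F\<^sup>2 * \<gamma> (Suc t))"
    using sum_norm_average_le[OF t, of "\<lambda>j. x j t" y] \<alpha>
    by (intro add_right_mono diff_right_mono divide_right_mono) (auto simp: z_def)
  finally show ?thesis
    by (simp add: mult_ac)
qed

lemma cumulative_bound:
  assumes y: "\<And>t. t \<in> {1..T} \<Longrightarrow> feasible t y" and yX: "y \<in> X" and s: "0 \<le> s"
  defines "M \<equiv> \<Sum>i=1..n. m i"
  shows "(\<Sum>t=1..T. \<Sum>i=1..n. f i t (x i t) - f i t y) + s * (\<Sum>t=1..T. \<Sum>i=1..n. norm (a i t))
      + (\<Sum>t=1..T. \<Sum>i=1..n. (err i t)\<^sup>2 / (2 * \<alpha> (Suc t)))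
    \<le> 2 * real n * R\<^sup>2 * (1 / \<alpha> 1 + H)
      + F2 * (1 + real M * s) * ((\<Sum>t=1..T. pert (Suc t)) + real n * (\<Sum>t=1..T. diam x t))
      + real M * s\<^sup>2 / 2 * (1 / \<gamma> 1 + (\<Sum>t=1..T. \<beta> (Suc t)))
      + 2 * real n * F\<^sup>2 * (\<Sum>t=1..T. \<gamma> (Suc t))"
proof -
  define S where "S = (\<lambda>t. \<Sum>i=1..n. (norm (x i t - y))\<^sup>2)"
  define dual where "dual = (\<lambda>i t. \<beta> (Suc t) / 2 * (norm (q i t - weight i s))\<^sup>2
      + ((norm (q i (Suc t) - weight i s))\<^sup>2 - (norm (q i t - weight i s))\<^sup>2) / (2 * \<gamma> (Suc t)))"
  have S0: "0 \<le> S t" for t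
    unfolding S_def by (intro sum_nonneg) auto
  have S_le: "S t \<le> real n * (4 * R\<^sup>2)" if "1 \<le> t" for t
  proof -
    have "S t \<le> (\<Sum>i=1..n. (2 * R)\<^sup>2)"
      unfolding S_def using that yX by (intro sum_mono power_mono norm_diff_X x_in_X) auto
    then show ?thesis by (simp add: power_mult_distrib)
  qed
  have primal: "(\<Sum>t=1..T. (S t - S (Suc t)) / (2 * \<alpha> (Suc t)) - \<mu> / 2 * S t)
      \<le> 2 * real n * R\<^sup>2 * (1 / \<alpha> 1 + H)"
  proof -
    have "(\<Sum>t=1..T. (S t - S (Suc t)) / (2 * \<alpha> (Suc t)) - \<mu> / 2 * S t)
        \<le> S 1 / (2 * \<alpha> 1) - S (Suc T) / (2 * \<alpha> (Suc T))
          + real n * (4 * R\<^sup>2) / 2 * (\<Sum>t=1..T. max 0 (1 / \<alpha> (Suc t) - 1 / \<alpha> t - \<mu>))"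
      by (intro primal_telescope S0 S_le)
    moreover have "0 \<le> S (Suc T) / (2 * \<alpha> (Suc T))"
      using S0 \<alpha>_pos[of "Suc T"] by simp
    moreover have "S 1 / (2 * \<alpha> 1) \<le> real n * (4 * R\<^sup>2) / (2 * \<alpha> 1)"
      using S_le[of 1] \<alpha>_pos[of 1] by (intro divide_right_mono) auto
    moreover have "real n * (4 * R\<^sup>2) / 2 * (\<Sum>t=1..T. max 0 (1 / \<alpha> (Suc t) - 1 / \<alpha> t - \<mu>))
        \<le> real n * (4 * R\<^sup>2) / 2 * H"
      by (intro mult_left_mono \<alpha>_step) auto
    ultimately show ?thesis
      by (simp add: algebra_simps)
  qed
  \<comment> \<open>The final dual distance is dropped; since \<open>q\<close> starts at zero, the
    initial one is just the squared norm of the weight vector.\<close>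
  have dual: "- (real M * s\<^sup>2 / 2 * (1 / \<gamma> 1)) \<le> (\<Sum>t=1..T. \<Sum>i=1..n. dual i t)"
  proof -
    have "- (s\<^sup>2 / (2 * \<gamma> 1)) * real (m i) \<le> (\<Sum>t=1..T. dual i t)" if i: "i \<in> {1..n}" for i
    proof -
      have "(norm (q i (Suc T) - weight i s))\<^sup>2 / (2 * \<gamma> (Suc T)) - (norm (q i 1 - weight i s))\<^sup>2 / (2 * \<gamma> 1)
          \<le> (\<Sum>t=1..T. dual i t)"
        unfolding dual_def by (rule dual_telescope[where Q = "\<lambda>t. (norm (q i t - weight i s))\<^sup>2"])
          (use \<gamma>_pos \<gamma>_step in auto)
      moreover have "0 \<le> (norm (q i (Suc T) - weight i s))\<^sup>2 / (2 * \<gamma> (Suc T))"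
        using \<gamma>_pos[of "Suc T"] by simp
      moreover have "(norm (q i 1 - weight i s))\<^sup>2 = real (m i) * s\<^sup>2"
        using q_first[OF i] by (simp add: weight_def norm_vec_of_const)
      ultimately show ?thesis
        by (simp add: mult_ac)
    qed
    then have "(\<Sum>i=1..n. - (s\<^sup>2 / (2 * \<gamma> 1)) * real (m i)) \<le> (\<Sum>i=1..n. \<Sum>t=1..T. dual i t)"
      by (rule sum_mono)
    also have "\<dots> = (\<Sum>t=1..T. \<Sum>i=1..n. dual i t)"
      by (rule sum.swap)
    also have "(\<Sum>i=1..n. - (s\<^sup>2 / (2 * \<gamma> 1)) * real (m i)) = - (s\<^sup>2 / (2 * \<gamma> 1)) * real M"
      by (simp only: M_def of_nat_sum sum_distrib_left)
    finally show ?thesis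
      by (simp add: mult_ac)
  qed
  have "(\<Sum>t=1..T. \<Sum>i=1..n. f i t (x i t) - f i t y) + s * (\<Sum>t=1..T. \<Sum>i=1..n. norm (a i t))
      + (\<Sum>t=1..T. \<Sum>i=1..n. (err i t)\<^sup>2 / (2 * \<alpha> (Suc t))) + (\<Sum>t=1..T. \<Sum>i=1..n. dual i t)
    = (\<Sum>t=1..T. (\<Sum>i=1..n. f i t (x i t) - f i t y) + s * (\<Sum>i=1..n. norm (a i t))
      + (\<Sum>i=1..n. (err i t)\<^sup>2 / (2 * \<alpha> (Suc t))) + (\<Sum>i=1..n. dual i t))"
    by (simp only: sum.distrib sum_distrib_left)
  also have "\<dots> \<le> (\<Sum>t=1..T. ((S t - S (Suc t)) / (2 * \<alpha> (Suc t)) - \<mu> / 2 * S t)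
      + F2 * (1 + real M * s) * (pert (Suc t) + real n * diam x t)
      + real M * s\<^sup>2 / 2 * \<beta> (Suc t) + 2 * real n * F\<^sup>2 * \<gamma> (Suc t))"
    unfolding S_def dual_def M_def by (intro sum_mono round_bound y s) auto
  also have "\<dots> = (\<Sum>t=1..T. (S t - S (Suc t)) / (2 * \<alpha> (Suc t)) - \<mu> / 2 * S t)
      + F2 * (1 + real M * s) * ((\<Sum>t=1..T. pert (Suc t)) + real n * (\<Sum>t=1..T. diam x t))
      + real M * s\<^sup>2 / 2 * (\<Sum>t=1..T. \<beta> (Suc t)) + 2 * real n * F\<^sup>2 * (\<Sum>t=1..T. \<gamma> (Suc t))"
    by (simp only: sum.distrib flip: sum_distrib_left)
  finally show ?thesis
    using primal dual unfolding distrib_left[of "real M * s\<^sup>2 / 2"] by linarith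
qed

lemma drift_nonneg: "0 \<le> drift n M B w F2"
  unfolding drift_def using F2_nonneg mixing_nonneg by simp

text \<open>The disagreement on the left is reserved for passing from local to network quantities.
  Its factor \<open>1 + s\<close> serves the regret at \<open>s = 0\<close> as well as the violation
  scaled by \<open>s\<close>.\<close>

lemma master_bound:
  assumes y: "\<And>t. t \<in> {1..T} \<Longrightarrow> feasible t y" and yX: "y \<in> X" and s: "0 \<le> s"
  defines "M \<equiv> \<Sum>i=1..n. m i"
  defines "K \<equiv> drift n M B w F2"
  shows "(\<Sum>t=1..T. \<Sum>i=1..n. f i t (x i t) - f i t y)
      + s * (\<Sum>t=1..T. \<Sum>i=1..n. norm (a i t))
      + (1 + s) * (real n * F2 * (\<Sum>t=1..T. diam x t))
    \<le> 2 * real n * R\<^sup>2 * (1 / \<alpha> 1 + H) + (1 + s) * (K * R)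
      + real n * ((1 + s) * K)\<^sup>2 / 2 * (\<Sum>t=1..T. \<alpha> (Suc t))
      + real M * s\<^sup>2 / 2 * (1 / \<gamma> 1 + (\<Sum>t=1..T. \<beta> (Suc t)))
      + 2 * real n * F\<^sup>2 * (\<Sum>t=1..T. \<gamma> (Suc t))"
proof -
  let ?e = "\<Sum>t=1..T. pert (Suc t)" and ?d = "\<Sum>t=1..T. diam x t" and ?\<Lambda> = "mixing n B w"
  have e0: "0 \<le> ?e" and d0: "0 \<le> ?d"
    by (intro sum_nonneg pert_nonneg diam_nonneg)+
  \<comment> \<open>The estimate \<open>1 + real M * s \<le> (1 + real M) * (1 + s)\<close>
    separates the dual scale, so \<open>K\<close> does not depend on \<open>s\<close>.\<close>
  have drift: "F2 * (1 + real M * s) * (?e + real n * ?d) + (1 + s) * (real n * F2 * ?d)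
      \<le> (1 + s) * (K * R) + (1 + s) * K * ?e"
  proof -
    have "F2 * (1 + real M * s) * (?e + real n * ?d) \<le> F2 * ((1 + real M) * (1 + s)) * (?e + real n * ?d)"
      using s F2_nonneg e0 d0
      by (intro mult_right_mono mult_left_mono) (auto simp: algebra_simps)
    moreover have "(1 + s) * (real n * F2 * ?d) \<le> (1 + real M) * ((1 + s) * (real n * F2 * ?d))"
      using s F2_nonneg d0 by (simp add: distrib_right)
    ultimately have "F2 * (1 + real M * s) * (?e + real n * ?d) + (1 + s) * (real n * F2 * ?d)
        \<le> (1 + s) * (F2 * (1 + real M) * (?e + 2 * real n * ?d))"
      by (simp add: algebra_simps)
    also have "\<dots> \<le> (1 + s) * (F2 * (1 + real M) * (?e + 2 * real n * (?\<Lambda> * (R + ?e))))"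
      using s F2_nonneg sum_diam_le[of T] by (intro mult_left_mono add_left_mono) auto
    also have "\<dots> \<le> (1 + s) * (F2 * (1 + real M) * ((1 + 2 * real n * ?\<Lambda>) * (R + ?e)))"
      using s F2_nonneg R_nonneg by (intro mult_left_mono) (auto simp: algebra_simps)
    also have "\<dots> = (1 + s) * (K * R) + (1 + s) * K * ?e"
      by (simp add: K_def drift_def algebra_simps)
    finally show ?thesis .
  qed
  \<comment> \<open>Young's inequality trades each linear error for the quadratic term available in
    \<open>cumulative_bound\<close>, leaving a multiple of the sum of
    \<open>\<alpha>\<close>.\<close>
  have "(1 + s) * K * ?e = (\<Sum>t=1..T. \<Sum>i=1..n. (1 + s) * K * err i t)"
    by (simp only: pert_Suc sum_distrib_left)
  also have "\<dots> \<le> (\<Sum>t=1..T. \<Sum>i=1..n. (err i t)\<^sup>2 / (2 * \<alpha> (Suc t)) + \<alpha> (Suc t) / 2 * ((1 + s) * K)\<^sup>2)"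
    by (intro sum_mono young_scaled \<alpha>_pos) auto
  also have "\<dots> = (\<Sum>t=1..T. \<Sum>i=1..n. (err i t)\<^sup>2 / (2 * \<alpha> (Suc t)))
      + (\<Sum>t=1..T. real n * ((1 + s) * K)\<^sup>2 / 2 * \<alpha> (Suc t))"
    by (simp add: sum.distrib mult_ac)
  also have "\<dots> = (\<Sum>t=1..T. \<Sum>i=1..n. (err i t)\<^sup>2 / (2 * \<alpha> (Suc t)))
      + real n * ((1 + s) * K)\<^sup>2 / 2 * (\<Sum>t=1..T. \<alpha> (Suc t))"
    by (simp only: sum_distrib_left)
  finally show ?thesis
    using cumulative_bound[where T = T, OF y yX s, folded M_def] drift by linarith
qed

section \<open>From local estimates to network regret and violation\<close>

lemma f_lipschitz:
  assumes "i \<in> {1..n}" "1 \<le> t" "u \<in> X" "v \<in> X"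
  shows "f i t u \<le> f i t v + F2 * norm (u - v)"
proof -
  have "\<bar>inner (v - u) (df i t u)\<bar> \<le> norm (v - u) * norm (df i t u)"
    by (rule Cauchy_Schwarz_ineq2)
  also have "\<dots> \<le> norm (v - u) * F2"
    using df_bound assms by (intro mult_left_mono) auto
  finally show ?thesis
    using f_subgradient[OF assms] by (simp add: norm_minus_commute mult.commute)
qed

text \<open>Each component changes by at most the absolute value of a coordinate of the transposed
  subgradient matrix applied to \<open>u - v\<close>; the bound on the adjoint then avoids a
  dimension factor.\<close>

lemma g_lipschitz:
  assumes i: "i \<in> {1..n}" and t: "1 \<le> t" and uv: "u \<in> X" "v \<in> X"
  shows "norm (pos_part (g i t u)) \<le> norm (pos_part (g i t v)) + F2 * norm (u - v)"
proof -
  let ?s = "transpose_mat_vec (m i) (dg i t u) (u - v)"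
  let ?s' = "vec_of (m i) (\<lambda>k. \<bar>coord ?s k\<bar>)"
  have "norm (pos_part (g i t u)) \<le> norm (pos_part (g i t v) + ?s')"
  proof (rule norm_le_coord)
    fix k
    show "\<bar>coord (pos_part (g i t u)) k\<bar> \<le> \<bar>coord (pos_part (g i t v) + ?s') k\<bar>"
    proof (cases "k < m i")
      case True
      have "coord ?s k = inner (u - v) (dg i t u k)"
        using True by (simp add: transpose_mat_vec_def coord_vec_of inner_commute)
      then show ?thesis
        using g_subgradient[OF i t uv True] True
        by (simp add: coord_pos_part coord_add coord_vec_of inner_diff_left)
    next
      case False
      then have "coord (g i t u) k = 0"
        using g_Rn[OF i t uv(1)] by (simp add: Rn_def)
      then show ?thesis by (simp add: coord_pos_part)
    qed
  qed
  also have "\<dots> \<le> norm (pos_part (g i t v)) + norm ?s'"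
    by (rule norm_triangle_ineq)
  also have "norm ?s' \<le> norm ?s"
    by (rule norm_le_coord) (simp add: coord_vec_of)
  also have "norm ?s \<le> F2 * norm (u - v)"
  proof (rule norm_transpose_mat_vec_le)
    fix v :: rseq
    have "norm (mat_vec (m i) (dg i t u) v) \<le> mat_norm (m i) (dg i t u) * norm v"
      by (rule norm_mat_vec_le)
    also have "\<dots> \<le> F2 * norm v"
      by (intro mult_right_mono dg_bound i t uv) auto
    finally show "norm (mat_vec (m i) (dg i t u) v) \<le> F2 * norm v" .
  qed
  finally show ?thesis
    by simp
qed

lemma F2_diam_ge:
  "i \<in> {1..n} \<Longrightarrow> j \<in> {1..n} \<Longrightarrow> F2 * norm (x i t - x j t) \<le> F2 * diam x t"
  by (intro mult_left_mono diam_ge F2_nonneg)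

text \<open>Network regret evaluates the loss of agent \<open>j\<close> at the states of all agents.
  Moving each evaluation to \<open>x j t\<close> costs \<open>F2\<close> times the
  disagreement.\<close>

lemma net_reg_le:
  "real n * net_reg n f x (\<lambda>_. y) T
    \<le> (\<Sum>t=1..T. \<Sum>i=1..n. f i t (x i t) - f i t y) + real n * F2 * (\<Sum>t=1..T. diam x t)"
proof -
  have n0: "0 < real n"
    using n_pos by simp
  have loss: "global_loss n f t (x i t) \<le> ((\<Sum>j=1..n. f j t (x j t)) + real n * F2 * diam x t) / real n"
    if "i \<in> {1..n}" "t \<in> {1..T}" for i t
  proof -
    have "(\<Sum>j=1..n. f j t (x i t)) \<le> (\<Sum>j=1..n. f j t (x j t) + F2 * diam x t)"
    proof (rule sum_mono)
      fix j assume j: "j \<in> {1..n}"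
      have "f j t (x i t) \<le> f j t (x j t) + F2 * norm (x i t - x j t)"
        using that j by (intro f_lipschitz x_in_X) auto
      then show "f j t (x i t) \<le> f j t (x j t) + F2 * diam x t"
        using F2_diam_ge[OF that(1) j, of t] by simp
    qed
    then show ?thesis
      unfolding global_loss_def by (intro divide_right_mono) (simp_all add: sum.distrib)
  qed
  have "(\<Sum>i=1..n. \<Sum>t=1..T. global_loss n f t (x i t))
      \<le> (\<Sum>i=1..n. \<Sum>t=1..T. ((\<Sum>j=1..n. f j t (x j t)) + real n * F2 * diam x t) / real n)"
    by (intro sum_mono loss)
  also have "\<dots> = (\<Sum>t=1..T. (\<Sum>j=1..n. f j t (x j t)) + real n * F2 * diam x t)"
    using n0 by (simp flip: sum_divide_distrib)
  also have "\<dots> = (\<Sum>t=1..T. \<Sum>j=1..n. f j t (x j t)) + real n * F2 * (\<Sum>t=1..T. diam x t)"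
    by (simp only: sum.distrib sum_distrib_left)
  finally show ?thesis
    using n0 by (simp add: net_reg_def global_loss_def right_diff_distrib sum_subtractf
        flip: sum_divide_distrib)
qed

lemma violation_le:
  "(\<Sum>i=1..n. \<Sum>t=1..T. norm (pos_part (global_constr n m g t (x i t)))) / real n
    \<le> (\<Sum>t=1..T. \<Sum>i=1..n. norm (a i t)) + real n * F2 * (\<Sum>t=1..T. diam x t)"
proof -
  have n0: "0 < real n"
    using n_pos by simp
  have constr: "norm (pos_part (global_constr n m g t (x i t)))
      \<le> (\<Sum>j=1..n. norm (a j t)) + real n * F2 * diam x t"
    if "i \<in> {1..n}" "t \<in> {1..T}" for i t
  proof -
    have "norm (pos_part (global_constr n m g t (x i t))) \<le> (\<Sum>j=1..n. norm (pos_part (g j t (x i t))))"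
      unfolding global_constr_def using that by (intro norm_pos_part_col_le g_Rn x_in_X) auto
    also have "\<dots> \<le> (\<Sum>j=1..n. norm (a j t) + F2 * diam x t)"
    proof (rule sum_mono)
      fix j assume j: "j \<in> {1..n}"
      have "norm (pos_part (g j t (x i t))) \<le> norm (a j t) + F2 * norm (x i t - x j t)"
        unfolding a_def using that j by (intro g_lipschitz x_in_X) auto
      then show "norm (pos_part (g j t (x i t))) \<le> norm (a j t) + F2 * diam x t"
        using F2_diam_ge[OF that(1) j, of t] by simp
    qed
    finally show ?thesis
      by (simp add: sum.distrib)
  qed
  have "(\<Sum>i=1..n. \<Sum>t=1..T. norm (pos_part (global_constr n m g t (x i t))))
      \<le> (\<Sum>i=1..n. \<Sum>t=1..T. (\<Sum>j=1..n. norm (a j t)) + real n * F2 * diam x t)"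
    by (intro sum_mono constr)
  also have "\<dots> = real n * ((\<Sum>t=1..T. \<Sum>j=1..n. norm (a j t)) + real n * F2 * (\<Sum>t=1..T. diam x t))"
    by (simp add: sum.distrib flip: sum_distrib_left)
  finally show ?thesis
    using n0 by (simp add: divide_le_eq mult.commute)
qed

lemma loss_gap_ge:
  assumes "y \<in> X"
  shows "- (real n * F1 * real T) \<le> (\<Sum>t=1..T. \<Sum>i=1..n. f i t (x i t) - f i t y)"
proof -
  have "(\<Sum>t=1..T. \<Sum>i=1..n. - F1) \<le> (\<Sum>t=1..T. \<Sum>i=1..n. f i t (x i t) - f i t y)"
  proof (intro sum_mono)
    fix t i assume "t \<in> {1..T}" "i \<in> {1..n}"
    then show "- F1 \<le> f i t (x i t) - f i t y"
      using f_bound[of i t "x i t" y] x_in_X assms by force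
  qed
  then show ?thesis
    by (simp add: mult_ac)
qed

lemma feasible_pointsD:
  assumes "y \<in> feasible_points X n m g T"
  shows "y \<in> X" "t \<in> {1..T} \<Longrightarrow> feasible t y"
  using assms unfolding feasible_points_def feasible_def global_constr_def col_nonpos_iff by auto

lemma regret_bound:
  assumes y: "y \<in> feasible_points X n m g T"
  defines "K \<equiv> drift n (\<Sum>i=1..n. m i) B w F2"
  shows "real n * net_reg n f x (\<lambda>_. y) T
    \<le> 2 * real n * R\<^sup>2 * (1 / \<alpha> 1 + H) + K * R + real n * K\<^sup>2 / 2 * (\<Sum>t=1..T. \<alpha> (Suc t))
      + 2 * real n * (F1 + 2 * R * F2)\<^sup>2 * (\<Sum>t=1..T. \<gamma> (Suc t))"
  using master_bound[where T = T and s = 0, OF feasible_pointsD(2)[OF y] feasible_pointsD(1)[OF y]]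
    net_reg_le[of y T]
  by (simp add: K_def F_def)

lemma violation_bound:
  assumes y: "y \<in> feasible_points X n m g T" and s: "0 \<le> s"
  defines "M \<equiv> \<Sum>i=1..n. m i"
  defines "K \<equiv> drift n M B w F2"
  shows "s * ((\<Sum>i=1..n. \<Sum>t=1..T. norm (pos_part (global_constr n m g t (x i t)))) / real n)
    \<le> real n * F1 * real T + 2 * real n * R\<^sup>2 * (1 / \<alpha> 1 + H) + (1 + s) * (K * R)
      + real n * ((1 + s) * K)\<^sup>2 / 2 * (\<Sum>t=1..T. \<alpha> (Suc t))
      + real M * s\<^sup>2 / 2 * (1 / \<gamma> 1 + (\<Sum>t=1..T. \<beta> (Suc t)))
      + 2 * real n * (F1 + 2 * R * F2)\<^sup>2 * (\<Sum>t=1..T. \<gamma> (Suc t))" (is "s * ?v \<le> _")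
proof -
  let ?V = "\<Sum>t=1..T. \<Sum>i=1..n. norm (a i t)" and ?D = "real n * F2 * (\<Sum>t=1..T. diam x t)"
  have "0 \<le> ?D"
    by (intro mult_nonneg_nonneg sum_nonneg diam_nonneg F2_nonneg) auto
  have "s * ?v \<le> s * (?V + ?D)"
    by (intro mult_left_mono violation_le s)
  also have "\<dots> \<le> s * ?V + (1 + s) * ?D"
    using \<open>0 \<le> ?D\<close> by (simp add: distrib_left distrib_right)
  finally show ?thesis
    using master_bound[where T = T, OF feasible_pointsD(2)[OF y] feasible_pointsD(1)[OF y] s]
      loss_gap_ge[OF feasible_pointsD(1)[OF y], of T]
    unfolding K_def M_def F_def by linarith
qed

end

section \<open>Rates\<close>

text \<open>Write each power as \<open>real k\<close> times the power with exponent
  \<open>a - 1\<close>, which decreases in \<open>k\<close>. This serves both the growth of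
  \<open>1 / \<gamma> t\<close> and that of \<open>1 / \<alpha> t\<close>.\<close>

lemma powr_Suc_diff_le:
  assumes "a \<le> 1" "1 \<le> t"
  shows "real (Suc t) powr a - real t powr a \<le> real (Suc t) powr (a - 1)"
proof -
  have split: "real k powr a = real k * real k powr (a - 1)" if "1 \<le> k" for k :: nat
    using that powr_add[of "real k" 1 "a - 1"] by simp
  have "real t * real (Suc t) powr (a - 1) \<le> real t * real t powr (a - 1)"
    using assms by (intro mult_left_mono powr_mono2') auto
  then show ?thesis
    using split[of t] split[of "Suc t"] assms by (simp add: algebra_simps)
qed

lemma powr_Suc_diff_ge:
  assumes "0 < a" "a < 1"
  shows "(1 - a) / real (Suc t) powr a \<le> real (Suc t) powr (1 - a) - real t powr (1 - a)"
proof (cases "t = 0")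
  case True
  then show ?thesis using assms by simp
next
  case False
  have "\<exists>\<xi>. real t < \<xi> \<and> \<xi> < real (Suc t) \<and>
      real (Suc t) powr (1 - a) - real t powr (1 - a) = (real (Suc t) - real t) * ((1 - a) * \<xi> powr (1 - a - 1))"
    using False by (intro MVT2) (auto intro!: derivative_eq_intros)
  then obtain \<xi> where \<xi>: "real t < \<xi>" "\<xi> < real (Suc t)"
    "real (Suc t) powr (1 - a) - real t powr (1 - a) = (1 - a) * \<xi> powr (- a)"
    by auto
  have "real (Suc t) powr (- a) \<le> \<xi> powr (- a)"
    using \<xi> False assms by (intro powr_mono2') auto
  then have "(1 - a) * real (Suc t) powr (- a) \<le> (1 - a) * \<xi> powr (- a)"
    using assms by (intro mult_left_mono) auto
  then show ?thesis
    unfolding \<xi>(3) by (simp add: powr_minus_divide)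
qed

lemma sum_inverse_powr_le:
  assumes "0 < a" "a < 1"
  shows "(\<Sum>t=1..T. 1 / real (Suc t) powr a) \<le> real T powr (1 - a) / (1 - a)"
proof (induction T)
  case (Suc T)
  \<comment> \<open>The summation starts at the second power, so each summand may be enlarged by one
    index to match the increment of the telescoping bound.\<close>
  have "1 / real (Suc (Suc T)) powr a \<le> 1 / real (Suc T) powr a"
    using assms by (intro divide_left_mono powr_mono2) auto
  also have "\<dots> \<le> (real (Suc T) powr (1 - a) - real T powr (1 - a)) / (1 - a)"
    using powr_Suc_diff_ge[OF assms, of T] assms by (simp add: field_simps)
  finally show ?case
    using Suc.IH by (simp add: diff_divide_distrib)
qed simp

text \<open>The increments of \<^term>\<open>\<lambda>t. real t powr c\<close> tend to 0, so strong convexity absorbs all but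
  finitely many of them.\<close>

lemma sum_powr_increments_bounded:
  fixes c \<mu> :: real
  assumes "c < 1" "0 < \<mu>"
  shows "\<exists>H. \<forall>T. (\<Sum>t=1..T. max 0 (real (Suc t) powr c - real t powr c - \<mu>)) \<le> H"
proof -
  have "((\<lambda>t. real t powr (c - 1)) \<longlongrightarrow> 0) sequentially"
    using assms by (intro tendsto_neg_powr filterlim_real_sequentially) auto
  then have "\<forall>\<^sub>F t in sequentially. real t powr (c - 1) < \<mu>"
    using assms by (auto dest: order_tendstoD)
  then obtain N where N: "\<And>t. N \<le> t \<Longrightarrow> real t powr (c - 1) < \<mu>"
    by (auto simp: eventually_sequentially)
  let ?h = "\<lambda>t. max 0 (real (Suc t) powr c - real t powr c - \<mu>)"
  have "(\<Sum>t=1..T. ?h t) \<le> (\<Sum>t<N. ?h t)" for T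
  proof -
    have zero: "?h t = 0" if "1 \<le> t" "N \<le> t" for t
      using powr_Suc_diff_le[of c t] N[of "Suc t"] that assms by simp
    have "(\<Sum>t=1..T. ?h t) = (\<Sum>t\<in>{1..T} \<inter> {..<N}. ?h t)"
      using zero by (intro sum.mono_neutral_right) (auto simp: not_less)
    also have "\<dots> \<le> (\<Sum>t<N. ?h t)"
      by (intro sum_mono2) auto
    finally show ?thesis .
  qed
  then show ?thesis
    by blast
qed

theorem theorem2:
  fixes \<kappa> c \<mu> F1 F2 R w :: real and n M B :: nat
  assumes "0 < \<kappa>" "\<kappa> < 1"
    and "max \<kappa> (1 - \<kappa>) \<le> c" "c < 1"
    and "1 \<le> n"
  shows "\<exists>C>0. \<forall>p m X r f g df dg E W x q.
    (\<Sum>i=1..n. m i) = M \<longrightarrow>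
    function_assumption p X r R n m f g df dg F1 F2 \<longrightarrow>
    (\<forall>T\<ge>1. feasible_points X n m g T \<noteq> {}) \<longrightarrow>
    graph_assumption n E W w B \<longrightarrow>
    strong_convexity_assumption X n f df \<mu> \<longrightarrow>
    algorithm1 X n m g df dg W
      (\<lambda>t. 1 / real t powr c) (\<lambda>t. 1 / real t powr \<kappa>) (\<lambda>t. 1 / real t powr (1 - \<kappa>)) x q \<longrightarrow>
    (\<forall>T\<ge>1.
      (\<forall>xstar. is_arg_min (\<lambda>z. \<Sum>t=1..T. global_loss n f t z)
                 (\<lambda>z. z \<in> feasible_points X n m g T) xstar \<longrightarrow>
        net_reg n f x (\<lambda>t. xstar) T \<le> C * real T powr \<kappa>) \<and>
      (\<Sum>i=1..n. \<Sum>t=1..T. norm (pos_part (global_constr n m g t (x i t)))) / real n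
        \<le> C * real T powr (1 - \<kappa> / 2))"
proof -
  \<comment> \<open>\<open>H\<close> must be fixed before the problem data, while positivity of
    \<open>\<mu>\<close> comes only with the strong convexity assumption; hence the conditional
    form.\<close>
  obtain H where H: "0 < \<mu> \<Longrightarrow> (\<Sum>t=1..T. max 0 (real (Suc t) powr c - real t powr c - \<mu>)) \<le> H" for T
    using sum_powr_increments_bounded[OF \<open>c < 1\<close>, of \<mu>] by blast
  define F where "F = F1 + 2 * R * F2"
  define K where "K = drift n M B w F2"
  define A where "A = 2 * real n * R\<^sup>2 * (1 + H)"
  define C1 where "C1 = A + K * R + real n * K\<^sup>2 / 2 / (1 - c) + 2 * real n * F\<^sup>2 / \<kappa>"
  \<comment> \<open>The coefficients of \<open>real T\<close> once \<open>s\<close> is at most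
    \<open>real T\<close> and \<open>(1 + s)\<^sup>2\<close> is at most
    \<open>4 * s\<^sup>2\<close>; the leading \<open>real n * F1\<close> comes from the lower bound
    on the loss gap.\<close>
  define C2 where "C2 = real n * F1 + A + 2 * (K * R) + 2 * real n * K\<^sup>2 / (1 - c)
      + real M / 2 * (1 + 1 / (1 - \<kappa>)) + 2 * real n * F\<^sup>2 / \<kappa>"
  have c: "0 < c" "\<kappa> \<le> c" "1 - \<kappa> \<le> c"
    using assms by auto
  show ?thesis
  \<comment> \<open>The \<open>1\<close> in the maximum guarantees a positive constant.\<close>
  proof (intro exI[of _ "max 1 (max (C1 / real n) C2)"] conjI allI impI)
    fix p m X r f g df dg E W x q and T :: nat
    assume M: "(\<Sum>i=1..n. m i) = M"
      and fa: "function_assumption p X r R n m f g df dg F1 F2"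
      and feas: "\<forall>T\<ge>1. feasible_points X n m g T \<noteq> {}"
      and ga: "graph_assumption n E W w B"
      and sc: "strong_convexity_assumption X n f df \<mu>"
      and alg: "algorithm1 X n m g df dg W
        (\<lambda>t. 1 / real t powr c) (\<lambda>t. 1 / real t powr \<kappa>) (\<lambda>t. 1 / real t powr (1 - \<kappa>)) x q"
      and T: "1 \<le> T"
    have \<mu>: "0 < \<mu>"
      using sc by (simp add: strong_convexity_assumption_def)
    have alg: "online_algorithm n E W w B p m X r R f g df dg F1 F2 \<mu>
      (\<lambda>t. 1 / real t powr c) (\<lambda>t. 1 / real t powr \<kappa>) (\<lambda>t. 1 / real t powr (1 - \<kappa>)) x q H"
    proof
      fix t :: nat assume t: "1 \<le> t"
      show "1 / real (Suc t) powr \<kappa> \<le> 1 / real t powr \<kappa>"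
        using t assms by (intro divide_left_mono powr_mono2) auto
      show "1 / real (Suc t) powr \<kappa> * (1 / real (Suc t) powr (1 - \<kappa>)) \<le> 1"
        by (simp flip: powr_add)
      show "1 / (1 / real (Suc t) powr (1 - \<kappa>)) - 1 / (1 / real t powr (1 - \<kappa>)) \<le> 1 / real (Suc t) powr \<kappa>"
        using powr_Suc_diff_le[of "1 - \<kappa>" t] t assms by (simp add: powr_minus_divide)
    next
      fix T
      show "(\<Sum>t=1..T. max 0 (1 / (1 / real (Suc t) powr c) - 1 / (1 / real t powr c) - \<mu>)) \<le> H"
        using H[OF \<mu>, of T] by simp
    qed (use assms fa ga sc alg in auto)
    have n0: "1 \<le> real n" and T1: "1 \<le> real T"
      using assms T by auto
    have H0: "0 \<le> H"
      using H[OF \<mu>, of 0] by simp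
    then have A0: "0 \<le> A"
      by (simp add: A_def)
    have KR0: "0 \<le> K * R"
      unfolding K_def
      using online_algorithm.drift_nonneg[OF alg] online_algorithm.R_nonneg[OF alg]
      by (rule mult_nonneg_nonneg)
    have one: "1 / (1 / real 1 powr c) = 1" "1 / (1 / real 1 powr (1 - \<kappa>)) = 1"
      by simp_all
    have sum_\<alpha>: "(\<Sum>t=1..T. 1 / real (Suc t) powr c) \<le> real T powr (1 - c) / (1 - c)"
      using c assms by (intro sum_inverse_powr_le) auto
    have sum_\<beta>: "(\<Sum>t=1..T. 1 / real (Suc t) powr \<kappa>) \<le> real T powr (1 - \<kappa>) / (1 - \<kappa>)"
      using assms by (intro sum_inverse_powr_le) auto
    have sum_\<gamma>: "(\<Sum>t=1..T. 1 / real (Suc t) powr (1 - \<kappa>)) \<le> real T powr \<kappa> / \<kappa>"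
      using sum_inverse_powr_le[of "1 - \<kappa>" T] assms by simp
    show "net_reg n f x (\<lambda>t. xstar) T \<le> max 1 (max (C1 / real n) C2) * real T powr \<kappa>"
      if "is_arg_min (\<lambda>z. \<Sum>t=1..T. global_loss n f t z) (\<lambda>z. z \<in> feasible_points X n m g T) xstar"
      for xstar
    proof -
      let ?P = "real T powr \<kappa>"
      have y: "xstar \<in> feasible_points X n m g T"
        using that by (simp add: is_arg_min_def)
      \<comment> \<open>The regret uses \<open>1 - \<kappa> \<le> c\<close>: the sum of
        \<open>\<alpha>\<close> then grows no faster than that of \<open>\<gamma>\<close>.\<close>
      have P: "1 \<le> ?P" "real T powr (1 - c) \<le> ?P"
        using T1 assms c by (auto intro: ge_one_powr_ge_zero powr_mono)
      have "real n * net_reg n f x (\<lambda>t. xstar) T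
          \<le> A + K * R + real n * K\<^sup>2 / 2 * (\<Sum>t=1..T. 1 / real (Suc t) powr c)
            + 2 * real n * F\<^sup>2 * (\<Sum>t=1..T. 1 / real (Suc t) powr (1 - \<kappa>))"
        using online_algorithm.regret_bound[OF alg y] unfolding one M A_def K_def F_def .
      also have "\<dots> \<le> A + K * R + real n * K\<^sup>2 / 2 * (real T powr (1 - c) / (1 - c)) + 2 * real n * F\<^sup>2 * (?P / \<kappa>)"
        by (intro order_refl add_mono mult_left_mono sum_\<alpha> sum_\<gamma>) auto
      also have "\<dots> \<le> A * ?P + K * R * ?P + real n * K\<^sup>2 / 2 * (?P / (1 - c)) + 2 * real n * F\<^sup>2 * (?P / \<kappa>)"
        using P A0 KR0 assms
        by (intro add_mono mult_left_mono divide_right_mono)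
          (auto intro: mult_left_mono[of 1 ?P, simplified])
      also have "\<dots> = C1 * ?P"
        by (simp add: C1_def algebra_simps)
      finally have "net_reg n f x (\<lambda>t. xstar) T \<le> C1 / real n * ?P"
        using n0 by (simp add: field_simps)
      also have "\<dots> \<le> max 1 (max (C1 / real n) C2) * ?P"
        by (intro mult_right_mono) auto
      finally show ?thesis .
    qed
    show "(\<Sum>i=1..n. \<Sum>t=1..T. norm (pos_part (global_constr n m g t (x i t)))) / real n
        \<le> max 1 (max (C1 / real n) C2) * real T powr (1 - \<kappa> / 2)" (is "?v \<le> _")
    proof -
      obtain y where y: "y \<in> feasible_points X n m g T"
        using feas T by blast
      \<comment> \<open>This scale balances the dual cost, of order
        \<open>s\<^sup>2 * real T powr (1 - \<kappa>)\<close>, against the trivial loss gap of order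
        \<open>real T\<close>.\<close>
      define s where "s = real T powr (\<kappa> / 2)"
      have s1: "1 \<le> s"
        unfolding s_def using T1 assms by (intro ge_one_powr_ge_zero) auto
      have s_T: "s \<le> real T"
        unfolding s_def using T1 assms powr_mono[of "\<kappa> / 2" 1 "real T"] by simp
      have s2: "s\<^sup>2 = real T powr \<kappa>"
        by (simp add: s_def power2_eq_square flip: powr_add)
      \<comment> \<open>Used with \<open>b = c\<close> for the \<open>\<alpha>\<close> sum, which is
        where \<open>\<kappa> \<le> c\<close> enters, with \<open>b = \<kappa>\<close> for the
        \<open>\<beta>\<close> sum, and with \<open>b = 1\<close> for \<open>s\<^sup>2\<close>
        alone.\<close>
      have prod: "s\<^sup>2 * real T powr (1 - b) \<le> real T" if "\<kappa> \<le> b" for b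
        unfolding s2 using T1 that powr_mono[of "\<kappa> + (1 - b)" 1 "real T"] by (simp flip: powr_add)
      have s2_T: "s\<^sup>2 \<le> real T"
        using prod[of 1] assms T1 by simp
      have "s * ?v \<le> real n * F1 * real T + A + (1 + s) * (K * R)
          + real n * ((1 + s) * K)\<^sup>2 / 2 * (\<Sum>t=1..T. 1 / real (Suc t) powr c)
          + real M * s\<^sup>2 / 2 * (1 + (\<Sum>t=1..T. 1 / real (Suc t) powr \<kappa>))
          + 2 * real n * F\<^sup>2 * (\<Sum>t=1..T. 1 / real (Suc t) powr (1 - \<kappa>))"
        using online_algorithm.violation_bound[OF alg y, of s] s1 unfolding one M A_def K_def F_def by simp
      also have "\<dots> \<le> real n * F1 * real T + A + (1 + s) * (K * R)
          + real n * ((1 + s) * K)\<^sup>2 / 2 * (real T powr (1 - c) / (1 - c))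
          + real M * s\<^sup>2 / 2 * (1 + real T powr (1 - \<kappa>) / (1 - \<kappa>))
          + 2 * real n * F\<^sup>2 * (real T powr \<kappa> / \<kappa>)"
        by (intro order_refl add_mono mult_left_mono sum_\<alpha> sum_\<beta> sum_\<gamma>)
            (use assms in auto)
      also have "\<dots> \<le> real n * F1 * real T + A * real T + 2 * (K * R) * real T
          + 2 * real n * K\<^sup>2 / (1 - c) * real T
          + real M / 2 * (1 + 1 / (1 - \<kappa>)) * real T
          + 2 * real n * F\<^sup>2 / \<kappa> * real T"
      proof (intro add_mono order_refl)
        show "A \<le> A * real T"
          using A0 T1 mult_left_mono[of 1 "real T" A] by simp
        have "(1 + s) * (K * R) \<le> (2 * real T) * (K * R)"
          using KR0 s_T T1 by (intro mult_right_mono) auto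
        then show "(1 + s) * (K * R) \<le> 2 * (K * R) * real T"
          by (simp add: mult_ac)
        have "real n * ((1 + s) * K)\<^sup>2 / 2 * (real T powr (1 - c) / (1 - c))
            \<le> real n * ((2 * s) * K)\<^sup>2 / 2 * (real T powr (1 - c) / (1 - c))"
          using s1 assms unfolding power_mult_distrib[of _ K]
          by (intro mult_right_mono divide_right_mono mult_left_mono power_mono) auto
        also have "\<dots> = 2 * real n * K\<^sup>2 / (1 - c) * (s\<^sup>2 * real T powr (1 - c))"
          by (simp add: power_mult_distrib)
        also have "\<dots> \<le> 2 * real n * K\<^sup>2 / (1 - c) * real T"
          using prod[OF c(2)] assms by (intro mult_left_mono) auto
        finally show "real n * ((1 + s) * K)\<^sup>2 / 2 * (real T powr (1 - c) / (1 - c))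
            \<le> 2 * real n * K\<^sup>2 / (1 - c) * real T" .
        have "real M * s\<^sup>2 / 2 * (1 + real T powr (1 - \<kappa>) / (1 - \<kappa>))
            = real M / 2 * (s\<^sup>2 + s\<^sup>2 * real T powr (1 - \<kappa>) / (1 - \<kappa>))"
          by (simp add: distrib_left)
        also have "\<dots> \<le> real M / 2 * (real T + real T / (1 - \<kappa>))"
          using s2_T prod[OF order_refl] assms
          by (intro mult_left_mono add_mono divide_right_mono) auto
        also have "\<dots> = real M / 2 * (1 + 1 / (1 - \<kappa>)) * real T"
          by (simp add: algebra_simps)
        finally show "real M * s\<^sup>2 / 2 * (1 + real T powr (1 - \<kappa>) / (1 - \<kappa>))
            \<le> real M / 2 * (1 + 1 / (1 - \<kappa>)) * real T" .
        have "2 * real n * F\<^sup>2 / \<kappa> * real T powr \<kappa> \<le> 2 * real n * F\<^sup>2 / \<kappa> * real T"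
          using s2_T assms unfolding s2 by (intro mult_left_mono) auto
        then show "2 * real n * F\<^sup>2 * (real T powr \<kappa> / \<kappa>) \<le> 2 * real n * F\<^sup>2 / \<kappa> * real T"
          by simp
      qed
      also have "\<dots> = C2 * real T"
        unfolding C2_def by (simp only: distrib_right)
      also have "real T = s * real T powr (1 - \<kappa> / 2)"
        using T1 by (simp add: s_def flip: powr_add)
      finally have "s * ?v \<le> s * (C2 * real T powr (1 - \<kappa> / 2))"
        by (simp only: mult.left_commute[of C2])
      then have "?v \<le> C2 * real T powr (1 - \<kappa> / 2)"
        by (rule mult_left_le_imp_le) (use s1 in simp)
      also have "\<dots> \<le> max 1 (max (C1 / real n) C2) * real T powr (1 - \<kappa> / 2)"
        by (intro mult_right_mono) auto
      finally show ?thesis .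
    qed
  qed simp
qed

end
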